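(* Let $\mathbf{k}$ be a field, $n\ge 1$, and let $P=(p_{ij})$, $Q=(q_{ij})$ be $n\times n$ matrices with nonzero entries in $\mathbf{k}$, and $q\in\mathbf{k}^\times$, such that $p_{ij}q_{ij}=q^2$ and $q_{ij}=q_{ji}^{-1}$ for $i<j$, and $q_{ii}=p_{ii}$ for all $i$. Fix multilabels with repetitions allowed (nondecreasing finite sequences in $\{1,\dots,n\}$) $V$ (total row multilabel) and $S$ (total column multilabel). Let $\mathcal{W}_{V,S}$ be the set of all finite sequences $w=((K_1,L_1),\dots,(K_m,L_m))$, of any length $m$, of pairs of strictly increasing multilabels in $\{1,\dots,n\}$ with $|K_i|=|L_i|$ for every $i$, such that $:K_1K_2\cdots K_m:\,=V$ and $:L_1L_2\cdots L_m:\,=S$. For $w\in\mathcal{W}_{V,S}$ put $$d_w=d^{K_1}_{L_1}\cdots d^{K_m}_{L_m}\in\mathcal{M}_q(\mathbf{k}),\qquad D_w=D^{K_1}_{L_1}\cdots D^{K_m}_{L_m}\in\mathcal{M}(P,Q;\mathbf{k},n),$$ $$\theta(w)=\zeta_l^{-1}(L_1L_2\cdots L_m)\,\zeta_r^{-1}(K_1K_2\cdots K_m)\in\mathbf{k}^\times .$$ Then for every finitely supported family of scalars $(c_w)_{w\in\mathcal{W}_{V,S}}$ in $\mathbf{k}$, $$\sum_{w} c_w\, d_w=0\ \text{ in } \mathcal{M}_q(\mathbf{k})\quad\Longleftrightarrow\quad \sum_{w} c_w\,\theta(w)\, D_w=0\ \text{ in } \mathcal{M}(P,Q;\mathbf{k},n).$$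 Consequently $(c_w)_w\mapsto(\theta(w)c_w)_w$ is a one-to-one correspondence between the homogeneous identities (with total row multilabel $V$ and total column multilabel $S$) among 1-parametric quantum minors and those among multiparametric quantum minors.
   Context: A multilabel is a finite tuple of elements of $\{1,\dots,n\}$. Juxtaposition denotes concatenation, and $:J:$ denotes the ascendingly (nondecreasingly) ordered rearrangement of $J$, with repetitions kept. Multiparametric quantum matrix algebra: $\mathcal{M}(P,Q;\mathbf{k},n)$ is the associative unital $\mathbf{k}$-algebra with generators $T^i_j$ ($i,j=1,\dots,n$; upper index = row, lower index = column) and relations $T^k_iT^k_j=q_{ij}T^k_jT^k_i$ for $i<j$; $T^k_iT^l_i=p_{kl}T^l_iT^k_i$ for $k<l$; $q_{ij}T^k_jT^l_i=p_{kl}T^l_iT^k_j$ for $i<j$, $k<l$; $T^k_iT^l_j-q_{ij}q_{kl}^{-1}T^l_jT^k_i=(q_{ij}-p_{ij}^{-1})T^k_jT^l_i$ for $i<j$, $k<l$. The 1-parametric algebra $\mathcal{M}_q(\mathbf{k})$, with generators denoted $t^i_j$, is the special case $P=Q$ with $q_{ij}=q$ for $i<j$ and $q_{ij}=q^{-1}$ for $i>j$. Reordering factors: $S_r(q,Q)$ is the unital algebra with generators $r_1,\dots,r_n$ and relations $r_ir_j=q\,q_{ij}^{-1}r_jr_i$ ($i<j$). $S_l(q,Q)$ is the unital algebra with generators $l^1,\dots,l^n$ and relations $l^il^j=q_{ij}q^{-1}l^jl^i$ ($i<j$). For a multilabel $J=(j_1,\dots,j_s)$ write $r_J=r_{j_1}\cdots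 r_{j_s}$ and $l^J=l^{j_1}\cdots l^{j_s}$. The scalars $\zeta_r(J),\zeta_l(J)\in\mathbf{k}^\times$ are defined by $r_J=\zeta_r(J)\,r_{:J:}$ and $l^J=\zeta_l(J)\,l^{:J:}$. Let $\Lambda_P$ be the unital algebra with generators $e^1,\dots,e^n$ and relations $e^ie^j+p_{ij}^{-1}e^je^i=0$ ($i<j$), $(e^i)^2=0$. For a multilabel $J=(j_1,\dots,j_s)$ without repetitions, $\epsilon_P(J)\in\mathbf{k}^\times$ is defined by $e^{j_1}\cdots e^{j_s}=\epsilon_P(J)\,e^{:J:}$. In the 1-parametric case $\epsilon_P(\sigma K)=(-q)^{\ell(\sigma)}$ for $K$ strictly increasing, where $\ell(\sigma)$ is the number of inversions of $\sigma$. Quantum minors: for strictly increasing multilabels $K=(k_1,\dots,k_m)$ (rows) and $L=(l_1,\dots,l_m)$ (columns), $$D^K_L=\sum_{\sigma\in\Sigma(m)}\epsilon_P(\sigma K)\,T^{k_{\sigma(1)}}_{l_1}\cdots T^{k_{\sigma(m)}}_{l_m},\qquad \sigma K=(k_{\sigma(1)},\dots,k_{\sigma(m)}),$$ where $\Sigma(m)$ is the symmetric group, and $$d^K_L=\sum_{\sigma\in\Sigma(m)}(-q)^{\ell(\sigma)}\,t^{k_{\sigma(1)}}_{l_1}\cdots t^{k_{\sigma(m)}}_{l_m}$$ is the quantum minor of the 1-parametric algebra. *)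

theory Defs
  imports
    "HOL-Library.Poly_Mapping"
    "HOL-Combinatorics.Permutations"
    "HOL-Algebra.QuotRing"
    "HOL-Algebra.Module"
begin

section \<open>Unital associative algebras given by generators and relations\<close>

text \<open>
  A word over \<open>'g\<close>, as an element of the free monoid (written additively, since
  multiplication of \<^typ>\<open>'a \<Rightarrow>\<^sub>0 'b\<close> is convolution over an additive monoid).
  Hence \<open>'g word \<Rightarrow>\<^sub>0 'k\<close> is the free noncommutative \<open>'k\<close>-algebra on \<open>'g\<close>.
\<close>

datatype 'g word = Word (letters: "'g list")

instantiation word :: (type) monoid_add
begin

definition zero_word :: "'g word"
  where "zero_word = Word []"

definition plus_word :: "'g word \<Rightarrow> 'g word \<Rightarrow> 'g word"
  where "plus_word u v = Word (letters u @ letters v)"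

instance
  by standard (auto simp: zero_word_def plus_word_def)

end

type_synonym ('g, 'k) free_poly = "'g word \<Rightarrow>\<^sub>0 'k"

definition free_algebra :: "'g set \<Rightarrow> ('g, 'k::field) free_poly ring"
  where "free_algebra G =
    \<lparr>carrier = {f. \<forall>w \<in> Poly_Mapping.keys f. set (letters w) \<subseteq> G},
     mult = (*), one = 1, zero = 0, add = (+)\<rparr>"

definition gen :: "'g \<Rightarrow> ('g, 'k::field) free_poly"
  where "gen x = Poly_Mapping.single (Word [x]) 1"

definition const :: "'k \<Rightarrow> ('g, 'k::field) free_poly"
  where "const c = Poly_Mapping.single (Word []) c"

text \<open>
  The \<open>'k\<close>-algebra with generators \<open>G\<close> and relations \<open>f = 0\<close> for \<open>f \<in> R\<close>.  Its elements
  are cosets of the two-sided ideal generated by \<open>R\<close>.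
\<close>

definition presented_algebra ::
    "'g set \<Rightarrow> ('g, 'k::field) free_poly set \<Rightarrow> ('k, ('g, 'k) free_poly set) module"
  where "presented_algebra G R =
    (let F = free_algebra G; I = Idl\<^bsub>F\<^esub> R; A = F Quot I
     in ring.extend A (module.fields (\<lambda>c x. (I +>\<^bsub>F\<^esub> const c) \<otimes>\<^bsub>A\<^esub> x)))"

definition presented_gen ::
    "'g set \<Rightarrow> ('g, 'k::field) free_poly set \<Rightarrow> 'g \<Rightarrow> ('g, 'k) free_poly set"
  where "presented_gen G R x = (Idl\<^bsub>free_algebra G\<^esub> R) +>\<^bsub>free_algebra G\<^esub> gen x"

definition list_prod :: "('a, 'b) monoid_scheme \<Rightarrow> 'a list \<Rightarrow> 'a"
  where "list_prod A xs = foldr (\<lambda>x y. x \<otimes>\<^bsub>A\<^esub> y) xs \<one>\<^bsub>A\<^esub>"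

lemma letters_zero [simp]: "letters 0 = []"
  by (simp add: zero_word_def)

lemma letters_plus [simp]: "letters (u + v) = letters u @ letters v"
  by (simp add: plus_word_def)

lemma ring_free_algebra: "ring (free_algebra G :: ('g, 'k::field) free_poly ring)"
proof -
  define C :: "('g, 'k) free_poly set"
    where "C = {f. \<forall>w \<in> Poly_Mapping.keys f. set (letters w) \<subseteq> G}"
  have F: "free_algebra G = \<lparr>carrier = C, mult = (*), one = 1, zero = 0, add = (+)\<rparr>"
    by (simp add: free_algebra_def C_def)
  have add: "f + g \<in> C" if "f \<in> C" "g \<in> C" for f g
    using that Poly_Mapping.keys_add[of f g] unfolding C_def by blast
  have mult: "f * g \<in> C" if "f \<in> C" "g \<in> C" for f g
    using that keys_mult[of f g] unfolding C_def by fastforce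
  have one: "1 \<in> C" and zero: "0 \<in> C"
    by (auto simp: C_def)
  have uminus: "- f \<in> C" if "f \<in> C" for f
    using that by (simp add: C_def)
  have neg: "\<exists>g \<in> C. f + g = 0" if "f \<in> C" for f
    using uminus[OF that] by (intro bexI[of _ "- f"]) simp_all
  show ?thesis
    unfolding F
    by (intro ringI abelian_groupI monoidI)
       (simp_all add: add mult one zero neg algebra_simps)
qed


lemma free_algebra_closed:
  fixes f g :: "('g, 'k::field) free_poly"
  shows "x \<in> G \<Longrightarrow> (gen x :: ('g, 'k) free_poly) \<in> carrier (free_algebra G)"
    and "(const c :: ('g, 'k) free_poly) \<in> carrier (free_algebra G)"
    and "f \<in> carrier (free_algebra G) \<Longrightarrow> g \<in> carrier (free_algebra G) \<Longrightarrow>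
      f * g \<in> carrier (free_algebra G)"
    and "f \<in> carrier (free_algebra G) \<Longrightarrow> g \<in> carrier (free_algebra G) \<Longrightarrow>
      f + g \<in> carrier (free_algebra G)"
    and "f \<in> carrier (free_algebra G) \<Longrightarrow> g \<in> carrier (free_algebra G) \<Longrightarrow>
      f - g \<in> carrier (free_algebra G)"
proof -
  show "x \<in> G \<Longrightarrow> (gen x :: ('g, 'k) free_poly) \<in> carrier (free_algebra G)"
    "(const c :: ('g, 'k) free_poly) \<in> carrier (free_algebra G)"
    by (simp_all add: free_algebra_def gen_def const_def)
  assume f: "f \<in> carrier (free_algebra G)" and g: "g \<in> carrier (free_algebra G)"
  show "f * g \<in> carrier (free_algebra G)"
    using f g keys_mult[of f g] unfolding free_algebra_def by fastforce
  show "f + g \<in> carrier (free_algebra G)"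
    using f g Poly_Mapping.keys_add[of f g] unfolding free_algebra_def by auto
  show "f - g \<in> carrier (free_algebra G)"
    using f g keys_diff[of f g] unfolding free_algebra_def by auto
qed


section \<open>The quantum matrix algebras\<close>

definition qmatrix_gens :: "nat \<Rightarrow> (nat \<times> nat) set"
  where "qmatrix_gens n = {1..n} \<times> {1..n}"

text \<open>The letter \<open>(i, j)\<close> stands for the generator with row (upper) index \<open>i\<close> and column (lower) index \<open>j\<close>.\<close>

definition qmatrix_rels ::
    "nat \<Rightarrow> (nat \<Rightarrow> nat \<Rightarrow> 'k) \<Rightarrow> (nat \<Rightarrow> nat \<Rightarrow> 'k) \<Rightarrow> (nat \<times> nat, 'k::field) free_poly set"
  where "qmatrix_rels n P Q =
    {gen (k,i) * gen (k,j) - const (Q i j) * gen (k,j) * gen (k,i) | i j k.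
       i \<in> {1..n} \<and> j \<in> {1..n} \<and> k \<in> {1..n} \<and> i < j} \<union>
    {gen (k,i) * gen (l,i) - const (P k l) * gen (l,i) * gen (k,i) | i k l.
       i \<in> {1..n} \<and> k \<in> {1..n} \<and> l \<in> {1..n} \<and> k < l} \<union>
    {const (Q i j) * gen (k,j) * gen (l,i) - const (P k l) * gen (l,i) * gen (k,j) | i j k l.
       i \<in> {1..n} \<and> j \<in> {1..n} \<and> k \<in> {1..n} \<and> l \<in> {1..n} \<and> i < j \<and> k < l} \<union>
    {gen (k,i) * gen (l,j) - const (Q i j * inverse (Q k l)) * gen (l,j) * gen (k,i)
       - const (Q i j - inverse (P i j)) * gen (k,j) * gen (l,i) | i j k l.
       i \<in> {1..n} \<and> j \<in> {1..n} \<and> k \<in> {1..n} \<and> l \<in> {1..n} \<and> i < j \<and> k < l}"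

lemma qmatrix_rels_closed: "qmatrix_rels n P Q \<subseteq> carrier (free_algebra (qmatrix_gens n))"
  unfolding qmatrix_rels_def by (auto intro!: free_algebra_closed simp: qmatrix_gens_def)

definition qmatrix_algebra ::
    "nat \<Rightarrow> (nat \<Rightarrow> nat \<Rightarrow> 'k::field) \<Rightarrow> (nat \<Rightarrow> nat \<Rightarrow> 'k) \<Rightarrow>
     ('k, (nat \<times> nat, 'k) free_poly set) module"
  where "qmatrix_algebra n P Q = presented_algebra (qmatrix_gens n) (qmatrix_rels n P Q)"

definition qmatrix_T ::
    "nat \<Rightarrow> (nat \<Rightarrow> nat \<Rightarrow> 'k::field) \<Rightarrow> (nat \<Rightarrow> nat \<Rightarrow> 'k) \<Rightarrow> nat \<Rightarrow> nat \<Rightarrow>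
     (nat \<times> nat, 'k) free_poly set"
  where "qmatrix_T n P Q i j = presented_gen (qmatrix_gens n) (qmatrix_rels n P Q) (i, j)"

text \<open>
  Parameter matrix of the 1-parametric algebra.  The diagonal never enters the relations;
  it is set to \<open>1\<close>.
\<close>

definition one_param :: "'k::field \<Rightarrow> nat \<Rightarrow> nat \<Rightarrow> 'k"
  where "one_param q i j = (if i < j then q else if i > j then inverse q else 1)"

abbreviation qmatrix_algebra1 ::
    "nat \<Rightarrow> 'k::field \<Rightarrow> ('k, (nat \<times> nat, 'k) free_poly set) module"
  where "qmatrix_algebra1 n q \<equiv> qmatrix_algebra n (one_param q) (one_param q)"

abbreviation qmatrix_t :: "nat \<Rightarrow> 'k::field \<Rightarrow> nat \<Rightarrow> nat \<Rightarrow> (nat \<times> nat, 'k) free_poly set"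
  where "qmatrix_t n q \<equiv> qmatrix_T n (one_param q) (one_param q)"


section \<open>Reordering factors\<close>

definition Sr_rels :: "nat \<Rightarrow> 'k \<Rightarrow> (nat \<Rightarrow> nat \<Rightarrow> 'k) \<Rightarrow> (nat, 'k::field) free_poly set"
  where "Sr_rels n q Q =
    {gen i * gen j - const (q * inverse (Q i j)) * gen j * gen i | i j.
       i \<in> {1..n} \<and> j \<in> {1..n} \<and> i < j}"

definition Sl_rels :: "nat \<Rightarrow> 'k \<Rightarrow> (nat \<Rightarrow> nat \<Rightarrow> 'k) \<Rightarrow> (nat, 'k::field) free_poly set"
  where "Sl_rels n q Q =
    {gen i * gen j - const (Q i j * inverse q) * gen j * gen i | i j.
       i \<in> {1..n} \<and> j \<in> {1..n} \<and> i < j}"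

definition Lambda_rels :: "nat \<Rightarrow> (nat \<Rightarrow> nat \<Rightarrow> 'k) \<Rightarrow> (nat, 'k::field) free_poly set"
  where "Lambda_rels n P =
    {gen i * gen j + const (inverse (P i j)) * gen j * gen i | i j.
       i \<in> {1..n} \<and> j \<in> {1..n} \<and> i < j} \<union>
    {gen i * gen i | i. i \<in> {1..n}}"

lemma Sr_rels_closed: "Sr_rels n q Q \<subseteq> carrier (free_algebra {1..n})"
  and Sl_rels_closed: "Sl_rels n q Q \<subseteq> carrier (free_algebra {1..n})"
  and Lambda_rels_closed: "Lambda_rels n P \<subseteq> carrier (free_algebra {1..n})"
  unfolding Sr_rels_def Sl_rels_def Lambda_rels_def by (auto intro!: free_algebra_closed)

text \<open>
  The nonzero scalar \<open>c\<close> such that \<open>x\<^bsub>j\<^sub>1\<^esub> \<cdots> x\<^bsub>j\<^sub>s\<^esub> = c \<cdot> x\<^bsub>:J:\<^esub>\<close> holds in the algebra generated by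
  \<open>x\<^sub>1, \<dots>, x\<^sub>n\<close> with relations \<open>R\<close>.  Here \<^term>\<open>sort J\<close> is \<open>:J:\<close>.
\<close>

definition reorder_factor :: "nat \<Rightarrow> (nat, 'k::field) free_poly set \<Rightarrow> nat list \<Rightarrow> 'k"
  where "reorder_factor n R J =
    (let A = presented_algebra {1..n} R; x = presented_gen {1..n} R
     in THE c. c \<noteq> 0 \<and> list_prod A (map x J) = c \<odot>\<^bsub>A\<^esub> list_prod A (map x (sort J)))"

definition zeta_r :: "nat \<Rightarrow> 'k::field \<Rightarrow> (nat \<Rightarrow> nat \<Rightarrow> 'k) \<Rightarrow> nat list \<Rightarrow> 'k"
  where "zeta_r n q Q J = reorder_factor n (Sr_rels n q Q) J"

definition zeta_l :: "nat \<Rightarrow> 'k::field \<Rightarrow> (nat \<Rightarrow> nat \<Rightarrow> 'k) \<Rightarrow> nat list \<Rightarrow> 'k"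
  where "zeta_l n q Q J = reorder_factor n (Sl_rels n q Q) J"

text \<open>Only meaningful for \<open>J\<close> without repetitions.\<close>

definition eps :: "nat \<Rightarrow> (nat \<Rightarrow> nat \<Rightarrow> 'k::field) \<Rightarrow> nat list \<Rightarrow> 'k"
  where "eps n P J = reorder_factor n (Lambda_rels n P) J"


section \<open>Quantum minors\<close>

text \<open>
  Permutations act on positions \<open>0, \<dots>, m - 1\<close>:  \<open>permute_list \<sigma> K = (k\<^bsub>\<sigma>(0)\<^esub>, \<dots>, k\<^bsub>\<sigma>(m-1)\<^esub>)\<close>
  is \<open>\<sigma>K\<close>.
\<close>

definition inversion_number :: "nat \<Rightarrow> (nat \<Rightarrow> nat) \<Rightarrow> nat"
  where "inversion_number m \<sigma> = card {(a, b). a < b \<and> b < m \<and> \<sigma> a > \<sigma> b}"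

definition D_minor ::
    "nat \<Rightarrow> (nat \<Rightarrow> nat \<Rightarrow> 'k::field) \<Rightarrow> (nat \<Rightarrow> nat \<Rightarrow> 'k) \<Rightarrow> nat list \<Rightarrow> nat list \<Rightarrow>
     (nat \<times> nat, 'k) free_poly set"
  where "D_minor n P Q K L =
    (let A = qmatrix_algebra n P Q in
     \<Oplus>\<^bsub>A\<^esub>\<sigma> \<in> {\<sigma>. \<sigma> permutes {..<length K}}.
       eps n P (permute_list \<sigma> K) \<odot>\<^bsub>A\<^esub>
         list_prod A (map2 (qmatrix_T n P Q) (permute_list \<sigma> K) L))"

definition d_minor ::
    "nat \<Rightarrow> 'k::field \<Rightarrow> nat list \<Rightarrow> nat list \<Rightarrow> (nat \<times> nat, 'k) free_poly set"
  where "d_minor n q K L =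
    (let A = qmatrix_algebra1 n q in
     \<Oplus>\<^bsub>A\<^esub>\<sigma> \<in> {\<sigma>. \<sigma> permutes {..<length K}}.
       ((- q) ^ inversion_number (length K) \<sigma>) \<odot>\<^bsub>A\<^esub>
         list_prod A (map2 (qmatrix_t n q) (permute_list \<sigma> K) L))"


section \<open>Products of minors with given total row and column multilabels\<close>

definition multilabel :: "nat \<Rightarrow> nat list \<Rightarrow> bool"
  where "multilabel n J \<longleftrightarrow> set J \<subseteq> {1..n}"

definition rows :: "(nat list \<times> nat list) list \<Rightarrow> nat list"
  where "rows w = concat (map fst w)"

definition cols :: "(nat list \<times> nat list) list \<Rightarrow> nat list"
  where "cols w = concat (map snd w)"

definition minor_words :: "nat \<Rightarrow> nat list \<Rightarrow> nat list \<Rightarrow> (nat list \<times> nat list) list set"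
  where "minor_words n V S =
    {w. (\<forall>(K, L) \<in> set w.
           multilabel n K \<and> sorted_wrt (<) K \<and> multilabel n L \<and> sorted_wrt (<) L \<and>
           length K = length L) \<and>
        sort (rows w) = V \<and> sort (cols w) = S}"

definition d_prod ::
    "nat \<Rightarrow> 'k::field \<Rightarrow> (nat list \<times> nat list) list \<Rightarrow> (nat \<times> nat, 'k) free_poly set"
  where "d_prod n q w = list_prod (qmatrix_algebra1 n q) (map (\<lambda>(K, L). d_minor n q K L) w)"

definition D_prod ::
    "nat \<Rightarrow> (nat \<Rightarrow> nat \<Rightarrow> 'k::field) \<Rightarrow> (nat \<Rightarrow> nat \<Rightarrow> 'k) \<Rightarrow> (nat list \<times> nat list) list \<Rightarrow>
     (nat \<times> nat, 'k) free_poly set"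
  where "D_prod n P Q w = list_prod (qmatrix_algebra n P Q) (map (\<lambda>(K, L). D_minor n P Q K L) w)"

definition theta ::
    "nat \<Rightarrow> 'k::field \<Rightarrow> (nat \<Rightarrow> nat \<Rightarrow> 'k) \<Rightarrow> (nat list \<times> nat list) list \<Rightarrow> 'k"
  where "theta n q Q w = inverse (zeta_l n q Q (cols w)) * inverse (zeta_r n q Q (rows w))"

text \<open>Finitely supported families indexed by \<open>W\<close>, extended by \<open>0\<close> outside \<open>W\<close>.\<close>

definition fin_families :: "'w set \<Rightarrow> ('w \<Rightarrow> 'k::zero) set"
  where "fin_families W = {c. finite {w. c w \<noteq> 0} \<and> {w. c w \<noteq> 0} \<subseteq> W}"

definition lin_comb :: "('k::zero, 'a, 'b) module_scheme \<Rightarrow> ('w \<Rightarrow> 'k) \<Rightarrow> ('w \<Rightarrow> 'a) \<Rightarrow> 'a"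
  where "lin_comb A c x = (\<Oplus>\<^bsub>A\<^esub>w \<in> {w. c w \<noteq> 0}. c w \<odot>\<^bsub>A\<^esub> x w)"

definition identities ::
    "('k::zero, 'a, 'b) module_scheme \<Rightarrow> 'w set \<Rightarrow> ('w \<Rightarrow> 'a) \<Rightarrow> ('w \<Rightarrow> 'k) set"
  where "identities A W x = {c \<in> fin_families W. lin_comb A c x = \<zero>\<^bsub>A\<^esub>}"

end

theory Submission
  imports Defs
begin

text \<open>
  The idea is to compare the two algebras before passing to quotients.  Both are quotients of
  the free algebra on the letters \<open>(i, j)\<close>.  A word has a list of row indices and a
  list of column indices; it is given as weight the product of \<open>q / Q i j\<close> over all inversions of
  the row list (pairs of entries \<open>i < j\<close> standing in the wrong order) and of \<open>Q i j / q\<close> over all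
  inversions of the column list.  Multiplying every word by its weight is an invertible linear map
  of the free algebra, the twist.

  The weight of \<open>u v\<close> is the product of the weights of \<open>u\<close> and \<open>v\<close> and of a factor for the inversions
  between the two parts, and this factor depends on the row and column multisets only.  Hence the
  twist is multiplicative up to nonzero scalars on homogeneous elements (\<open>twist_mult\<close>).  The defining
  relations are homogeneous, so the twist maps the ideal of the 1-parametric algebra onto that of the
  multiparametric one as soon as it does so for the relations with two letters, which is a
  direct computation with \<open>P i j * Q i j = q\<^sup>2\<close> (\<open>twist_qmatrix_rels\<close>, \<open>twist_ideal_iff\<close>).

  A product of quantum minors lifts to a homogeneous element of the free algebra.  The sign of a term of
  a 1-parametric minor is a product of \<open>- q\<close> over inversions, so the twist replaces \<open>- q\<close> by
  \<open>- q * (q / Q i j) = - P i j\<close>; this is the sign of the multiparametric minor.  What remains are the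
  inversions between different minors, which contribute the same scalar \<open>\<theta>(w)\<close> to all terms.  Thus
  the lift of \<open>d\<^sub>w\<close> is sent to \<open>\<theta>(w)\<close> times the lift of \<open>D\<^sub>w\<close> (\<open>twist_d_poly\<close>), and a linear combination of
  the former is in the one ideal if and only if its twist is in the other.

  The scalars \<open>\<zeta>\<^sub>r\<close>, \<open>\<zeta>\<^sub>l\<close> and \<open>\<epsilon>\<^sub>P\<close> are specified by equations in algebras with generators and relations,
  so they have to be identified with products over inversions (\<open>reorder_factor_eq\<close>).  Uniqueness
  means that an ordered monomial is not zero in its algebra; it follows from a linear functional on the
  free algebra that vanishes on the ideal but not on the monomial.
\<close>


section \<open>Weights of words given by products over inversions\<close>

primrec inversion_prod :: "(nat \<Rightarrow> nat \<Rightarrow> 'k::comm_monoid_mult) \<Rightarrow> nat list \<Rightarrow> 'k" where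
  "inversion_prod g [] = 1"
| "inversion_prod g (x # xs) = (\<Prod>y\<in>#mset xs. if y < x then g y x else 1) * inversion_prod g xs"

text \<open>
  The contribution of the inversions with the larger entry in a first block and the smaller
  one in a second block.  It takes multisets because it does not change when either
  block is rearranged; all homogeneity arguments below rest on this.
\<close>

definition cross_prod :: "(nat \<Rightarrow> nat \<Rightarrow> 'k::comm_monoid_mult) \<Rightarrow> nat multiset \<Rightarrow> nat multiset \<Rightarrow> 'k" where
  "cross_prod g A B = (\<Prod>x\<in>#A. \<Prod>y\<in>#B. if y < x then g y x else 1)"

lemma inversion_prod_append:
  "inversion_prod g (xs @ ys) = inversion_prod g xs * inversion_prod g ys * cross_prod g (mset xs) (mset ys)"
  by (induction xs) (simp_all add: cross_prod_def ac_simps)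

lemma inversion_prod_sorted: "sorted xs \<Longrightarrow> inversion_prod g xs = 1"
proof (induction xs)
  case (Cons x xs)
  have "(\<Prod>y\<in>#mset xs. if y < x then g y x else 1) = (\<Prod>y\<in>#mset xs. 1)"
    using Cons.prems by (intro arg_cong[where f = prod_mset] image_mset_cong) auto
  then show ?case using Cons by simp
qed simp

lemma inversion_prod_mult: "inversion_prod (\<lambda>i j. g i j * h i j) xs = inversion_prod g xs * inversion_prod h xs"
proof (induction xs)
  case (Cons x xs)
  have "(\<Prod>y\<in>#mset xs. if y < x then g y x * h y x else 1) =
    (\<Prod>y\<in>#mset xs. (if y < x then g y x else 1) * (if y < x then h y x else 1))"
    by (intro arg_cong[where f = prod_mset] image_mset_cong) auto
  then show ?case using Cons by (simp add: prod_mset.distrib ac_simps)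
qed simp

lemma inversion_prod_cong:
  assumes "\<And>i j. i \<in> set xs \<Longrightarrow> j \<in> set xs \<Longrightarrow> i < j \<Longrightarrow> g i j = h i j"
  shows "inversion_prod g xs = inversion_prod h xs"
  using assms
proof (induction xs)
  case (Cons x xs)
  have "(\<Prod>y\<in>#mset xs. if y < x then g y x else 1) = (\<Prod>y\<in>#mset xs. if y < x then h y x else 1)"
    using Cons.prems by (intro arg_cong[where f = prod_mset] image_mset_cong) auto
  then show ?case using Cons by simp
qed simp

lemma inversion_prod_one: "inversion_prod (\<lambda>i j. 1) xs = 1"
  by (induction xs) simp_all

lemma inversion_prod_inverse:
  fixes g h :: "nat \<Rightarrow> nat \<Rightarrow> 'k::comm_monoid_mult"
  assumes "\<And>i j. i \<in> set xs \<Longrightarrow> j \<in> set xs \<Longrightarrow> i < j \<Longrightarrow> g i j * h i j = 1"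
  shows "inversion_prod g xs * inversion_prod h xs = 1"
  using inversion_prod_cong[of xs "\<lambda>i j. g i j * h i j" "\<lambda>i j. 1"] assms
  by (simp add: inversion_prod_mult inversion_prod_one)

text \<open>
  This links the weights with the length of a permutation, in terms of which the signs of
  the 1-parametric minors are given.
\<close>

lemma inversion_prod_const:
  fixes c :: "'k::comm_monoid_mult"
  shows "inversion_prod (\<lambda>i j. c) xs = c ^ card {(a, b). a < b \<and> b < length xs \<and> xs ! b < xs ! a}"
proof (induction xs)
  case (Cons x xs)
  let ?I = "\<lambda>ys. {(a, b). a < b \<and> b < length ys \<and> ys ! b < ys ! a}"
  let ?N = "{b. b < length xs \<and> xs ! b < x}"
  have fin: "finite (?I xs)" for xs :: "nat list"
    by (rule finite_subset[of _ "{..<length xs} \<times> {..<length xs}"]) auto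
  have split: "?I (x # xs) = (\<lambda>b. (0, Suc b)) ` ?N \<union> (\<lambda>(a, b). (Suc a, Suc b)) ` ?I xs"
    (is "?L = ?A \<union> ?B")
  proof (intro subset_antisym subsetI)
    fix p assume "p \<in> ?L"
    then obtain a b where p: "p = (a, b)" "a < b" "b < length (x # xs)" "(x # xs) ! b < (x # xs) ! a"
      by auto
    then obtain b' where b: "b = Suc b'" by (cases b) auto
    show "p \<in> ?A \<union> ?B"
      using p b by (cases a) (auto simp: image_iff)
  qed auto
  have "card (?I (x # xs)) = card ?A + card ?B"
    unfolding split by (rule card_Un_disjoint) (use fin[of xs] in auto)
  also have "card ?A = card ?N" by (rule card_image) (auto simp: inj_on_def)
  also have "card ?B = card (?I xs)" by (rule card_image) (auto simp: inj_on_def)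
  finally have card: "card (?I (x # xs)) = card ?N + card (?I xs)" .
  have "(\<Prod>y\<in>#mset ys. if y < x then c else 1) = c ^ length (filter (\<lambda>y. y < x) ys)" for ys
    by (induction ys) auto
  then show ?case using Cons card by (simp add: power_add length_filter_conv_card)
qed simp


section \<open>Computing in an algebra given by generators and relations\<close>

abbreviation rel_ideal :: "'g set \<Rightarrow> ('g, 'k::field) free_poly set \<Rightarrow> ('g, 'k) free_poly set"
  where "rel_ideal G R \<equiv> Idl\<^bsub>free_algebra G\<^esub> R"

text \<open>
  Everything about the presented algebras is transported along this projection: relations between
  elements of the algebra become ideal membership of polynomials with noncommuting variables.
\<close>

definition quot :: "'g set \<Rightarrow> ('g, 'k::field) free_poly set \<Rightarrow> ('g, 'k) free_poly \<Rightarrow> ('g, 'k) free_poly set"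
  where "quot G R f = rel_ideal G R +>\<^bsub>free_algebra G\<^esub> f"

definition monom :: "'g list \<Rightarrow> ('g, 'k::field) free_poly"
  where "monom xs = Poly_Mapping.single (Word xs) 1"

lemma free_algebra_sel:
  "mult (free_algebra G) = (*)" "one (free_algebra G) = 1"
  "zero (free_algebra G) = 0" "add (free_algebra G) = (+)"
  by (simp_all add: free_algebra_def)

lemma zero_closed_free: "0 \<in> carrier (free_algebra G)"
  by (simp add: free_algebra_def)

lemma single_closed: "set (letters w) \<subseteq> G \<Longrightarrow> Poly_Mapping.single w a \<in> carrier (free_algebra G)"
  by (simp add: free_algebra_def)

lemma sum_closed: "(\<And>i. i \<in> A \<Longrightarrow> f i \<in> carrier (free_algebra G)) \<Longrightarrow> sum f A \<in> carrier (free_algebra G)"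
  by (induction A rule: infinite_finite_induct) (auto intro: free_algebra_closed zero_closed_free)

lemma a_inv_free:
  assumes "f \<in> carrier (free_algebra G)"
  shows "\<ominus>\<^bsub>free_algebra G\<^esub> f = - f"
proof -
  interpret F: ring "free_algebra G" by (rule ring_free_algebra)
  have "- f \<in> carrier (free_algebra G)"
    using free_algebra_closed(5)[OF zero_closed_free assms] by simp
  then show ?thesis
    using F.minus_equality[of "- f" f] assms by (simp add: free_algebra_sel)
qed

lemma a_minus_free:
  "f \<in> carrier (free_algebra G) \<Longrightarrow> g \<in> carrier (free_algebra G) \<Longrightarrow> f \<ominus>\<^bsub>free_algebra G\<^esub> g = f - g"
  by (simp add: a_minus_def a_inv_free free_algebra_sel)

lemma free_poly_expand:
  fixes f :: "('g, 'k::field) free_poly"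
  shows "f = (\<Sum>w\<in>Poly_Mapping.keys f. Poly_Mapping.single w (Poly_Mapping.lookup f w))"
  by (rule poly_mapping_eqI)
     (auto simp: lookup_sum lookup_single when_def sum.delta in_keys_iff)

text \<open>
  The ideal is spanned additively by the elements \<open>u * \<rho> * v\<close> with \<open>u\<close>, \<open>v\<close> scalar
  multiples of words.  This form of the statement makes it possible to transport ideals along additive
  maps that are not multiplicative.  For the proof one checks that the \<open>f\<close> all of whose products
  \<open>u * f * v\<close> satisfy \<open>N\<close> form an ideal, which contains the relations.
\<close>

lemma rel_ideal_induct:
  fixes R :: "('g, 'k::field) free_poly set"
  assumes f: "f \<in> rel_ideal G R" and R: "R \<subseteq> carrier (free_algebra G)"
    and N0: "N 0" and Nadd: "\<And>f g. N f \<Longrightarrow> N g \<Longrightarrow> N (f + g)" and Nneg: "\<And>f. N f \<Longrightarrow> N (- f)"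
    and Nrel: "\<And>u v a b \<rho>. set (letters u) \<subseteq> G \<Longrightarrow> set (letters v) \<subseteq> G \<Longrightarrow> \<rho> \<in> R \<Longrightarrow>
      N (Poly_Mapping.single u a * \<rho> * Poly_Mapping.single v b)"
  shows "N f"
proof -
  interpret F: ring "free_algebra G :: ('g, 'k) free_poly ring" by (rule ring_free_algebra)
  define J where "J = {f \<in> carrier (free_algebra G). \<forall>u v a b. set (letters u) \<subseteq> G \<longrightarrow>
    set (letters v) \<subseteq> G \<longrightarrow> N (Poly_Mapping.single u a * f * Poly_Mapping.single v b)}"
  have Nsum: "N (sum h A)" if "\<And>i. i \<in> A \<Longrightarrow> N (h i)" for h :: "'g word \<Rightarrow> ('g, 'k) free_poly" and A
    using that by (induction A rule: infinite_finite_induct) (auto intro: N0 Nadd)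
  have "ideal J (free_algebra G)"
  proof (rule idealI[OF ring_free_algebra])
    show "subgroup J (add_monoid (free_algebra G))"
    proof (rule F.add.subgroupI)
      show "J \<noteq> {}"
        using zero_closed_free N0 unfolding J_def by (auto intro!: exI[of _ 0])
    next
      fix f assume "f \<in> J"
      then show "\<ominus>\<^bsub>free_algebra G\<^esub> f \<in> J"
        using F.a_inv_closed[of f] Nneg unfolding J_def by (auto simp: a_inv_free)
    next
      fix f g assume "f \<in> J" "g \<in> J"
      then show "f \<oplus>\<^bsub>free_algebra G\<^esub> g \<in> J"
        unfolding J_def by (auto simp: free_algebra_sel distrib_left distrib_right
          intro!: Nadd free_algebra_closed)
    qed (auto simp: J_def)
  next
    fix f g :: "('g, 'k) free_poly" assume f: "f \<in> J" and g: "g \<in> carrier (free_algebra G)"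
    have keys: "set (letters w) \<subseteq> G" if "w \<in> Poly_Mapping.keys g" for w
      using g that by (auto simp: free_algebra_def)
    have "N (Poly_Mapping.single u a * (g * f) * Poly_Mapping.single v b)"
      if u: "set (letters u) \<subseteq> G" and v: "set (letters v) \<subseteq> G" for u v a b
    proof -
      have "Poly_Mapping.single u a * (g * f) * Poly_Mapping.single v b =
        (\<Sum>w\<in>Poly_Mapping.keys g. Poly_Mapping.single (u + w) (a * Poly_Mapping.lookup g w) * f * Poly_Mapping.single v b)"
        by (subst free_poly_expand[of g])
           (simp add: sum_distrib_left sum_distrib_right mult_single flip: mult.assoc)
      also have "N \<dots>" using f u v keys unfolding J_def by (intro Nsum) auto
      finally show ?thesis .
    qed
    then show "g \<otimes>\<^bsub>free_algebra G\<^esub> f \<in> J"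
      using f g unfolding J_def by (auto simp: free_algebra_sel intro: free_algebra_closed)
    have "N (Poly_Mapping.single u a * (f * g) * Poly_Mapping.single v b)"
      if u: "set (letters u) \<subseteq> G" and v: "set (letters v) \<subseteq> G" for u v a b
    proof -
      have "Poly_Mapping.single u a * (f * g) * Poly_Mapping.single v b =
        (\<Sum>w\<in>Poly_Mapping.keys g. Poly_Mapping.single u a * f * Poly_Mapping.single (w + v) (Poly_Mapping.lookup g w * b))"
        by (subst free_poly_expand[of g])
           (simp add: sum_distrib_left sum_distrib_right mult_single mult.assoc)
      also have "N \<dots>" using f u v keys unfolding J_def by (intro Nsum) auto
      finally show ?thesis .
    qed
    then show "f \<otimes>\<^bsub>free_algebra G\<^esub> g \<in> J"
      using f g unfolding J_def by (auto simp: free_algebra_sel intro: free_algebra_closed)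
  qed
  moreover have "R \<subseteq> J" using R Nrel unfolding J_def by auto
  ultimately have "f \<in> J" using F.genideal_minimal f by blast
  then have "N (Poly_Mapping.single 0 1 * f * Poly_Mapping.single 0 1)"
    unfolding J_def by (auto simp del: single_one)
  then show ?thesis by simp
qed

locale presentation =
  fixes G :: "'g set" and R :: "('g, 'k::field) free_poly set"
  assumes rels_closed: "R \<subseteq> carrier (free_algebra G)"
begin

abbreviation "A \<equiv> presented_algebra G R"
abbreviation "I \<equiv> rel_ideal G R"
abbreviation "F \<equiv> (free_algebra G :: ('g, 'k) free_poly ring)"

sublocale F: ring F by (rule ring_free_algebra)
sublocale I: ideal I F by (rule F.genideal_ideal[OF rels_closed])

lemma A_sel:
  "carrier A = carrier (F Quot I)" "mult A = mult (F Quot I)" "one A = one (F Quot I)"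
  "zero A = zero (F Quot I)" "add A = add (F Quot I)"
  by (simp_all add: presented_algebra_def Let_def ring.defs)

lemma abelian_monoid_A: "abelian_monoid A"
proof -
  interpret Q: ring "F Quot I" by (rule I.quotient_is_ring)
  show ?thesis
    by (rule abelian_monoidI)
       (simp_all add: A_sel Q.add.m_assoc Q.add.m_comm Q.add.m_lcomm)
qed

lemma quot_closed: "f \<in> carrier F \<Longrightarrow> quot G R f \<in> carrier A"
  unfolding A_sel quot_def FactRing_def by (auto intro: F.a_rcosetsI[OF I.a_subset])

lemma quot_mult:
  "f \<in> carrier F \<Longrightarrow> g \<in> carrier F \<Longrightarrow> quot G R f \<otimes>\<^bsub>A\<^esub> quot G R g = quot G R (f * g)"
  unfolding A_sel quot_def FactRing_def by (simp add: I.rcoset_mult_add free_algebra_sel)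

lemma quot_add:
  "f \<in> carrier F \<Longrightarrow> g \<in> carrier F \<Longrightarrow> quot G R f \<oplus>\<^bsub>A\<^esub> quot G R g = quot G R (f + g)"
  unfolding A_sel quot_def FactRing_def by (simp add: I.a_rcos_sum free_algebra_sel)

lemma quot_one: "\<one>\<^bsub>A\<^esub> = quot G R 1"
  unfolding A_sel quot_def FactRing_def by (simp add: free_algebra_sel)

lemma quot_zero: "\<zero>\<^bsub>A\<^esub> = quot G R 0"
  using F.zero_closed I.a_rcos_const[OF I.zero_closed]
  unfolding A_sel quot_def FactRing_def by (simp add: free_algebra_sel)

lemma quot_smult: "f \<in> carrier F \<Longrightarrow> c \<odot>\<^bsub>A\<^esub> quot G R f = quot G R (const c * f)"
  using quot_mult[OF free_algebra_closed(2), of f c]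
  by (simp add: presented_algebra_def Let_def ring.defs module.defs quot_def)

lemma quot_eq_iff:
  "f \<in> carrier F \<Longrightarrow> g \<in> carrier F \<Longrightarrow> quot G R f = quot G R g \<longleftrightarrow> f - g \<in> I"
  using F.quotient_eq_iff_same_a_r_cos[OF I.ideal_axioms, of f g]
  by (simp add: quot_def a_minus_free)

lemma quot_eq_zero_iff: "f \<in> carrier F \<Longrightarrow> quot G R f = \<zero>\<^bsub>A\<^esub> \<longleftrightarrow> f \<in> I"
  using quot_eq_iff[of f 0, OF _ zero_closed_free] by (simp add: quot_zero)

lemma list_prod_quot:
  assumes "\<And>x. x \<in> set xs \<Longrightarrow> h x \<in> carrier F"
  shows "list_prod A (map (\<lambda>x. quot G R (h x)) xs) = quot G R (prod_list (map h xs))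
    \<and> prod_list (map h xs) \<in> carrier F"
  using assms F.one_closed
  by (induction xs) (auto simp: list_prod_def quot_one quot_mult free_algebra_sel intro: free_algebra_closed)

lemma finsum_quot:
  assumes "finite X" "\<And>x. x \<in> X \<Longrightarrow> h x \<in> carrier F"
  shows "finsum A (\<lambda>x. quot G R (h x)) X = quot G R (sum h X)"
proof -
  interpret A: abelian_monoid A by (rule abelian_monoid_A)
  show ?thesis
    using assms
    by (induction X) (auto simp: quot_zero[symmetric] A.finsum_insert quot_closed quot_add sum_closed Pi_def)
qed

lemma lin_comb_quot:
  assumes fin: "finite {w. c w \<noteq> 0}"
    and x: "\<And>w. c w \<noteq> 0 \<Longrightarrow> x w = quot G R (h w)" and h: "\<And>w. c w \<noteq> 0 \<Longrightarrow> h w \<in> carrier F"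
  shows "lin_comb A c x = \<zero>\<^bsub>A\<^esub> \<longleftrightarrow> (\<Sum>w | c w \<noteq> 0. const (c w) * h w) \<in> I"
proof -
  interpret A: abelian_monoid A by (rule abelian_monoid_A)
  have "lin_comb A c x = finsum A (\<lambda>w. quot G R (const (c w) * h w)) {w. c w \<noteq> 0}"
    unfolding lin_comb_def using x h
    by (intro A.finsum_cong') (auto simp: quot_smult intro!: quot_closed free_algebra_closed)
  also have "\<dots> = quot G R (\<Sum>w | c w \<noteq> 0. const (c w) * h w)"
    using fin h by (intro finsum_quot) (auto intro!: free_algebra_closed)
  finally have "lin_comb A c x = quot G R (\<Sum>w | c w \<noteq> 0. const (c w) * h w)" .
  moreover have "(\<Sum>w | c w \<noteq> 0. const (c w) * h w) \<in> carrier F"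
    using h by (auto intro!: sum_closed free_algebra_closed)
  ultimately show ?thesis by (simp only: quot_eq_zero_iff)
qed

end

lemma monom_Nil: "monom [] = 1"
  by (simp add: monom_def flip: zero_word_def)

lemma monom_Cons: "monom (x # xs) = gen x * monom xs"
  by (simp add: monom_def gen_def mult_single plus_word_def)

lemma prod_list_gen: "prod_list (map gen xs) = monom xs"
  by (induction xs) (simp_all add: monom_Nil monom_Cons)

section \<open>Reordering factors as products over inversions\<close>

lemma (in presentation) list_prod_gens:
  assumes "set xs \<subseteq> G"
  shows "list_prod A (map (presented_gen G R) xs) = quot G R (monom xs)"
proof -
  have "presented_gen G R = (\<lambda>x. quot G R (gen x))"
    by (simp add: fun_eq_iff presented_gen_def quot_def)
  then show ?thesis
    using list_prod_quot[of xs gen] assms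
    by (auto simp: prod_list_gen intro: free_algebra_closed)
qed

lemma monom_closed: "set xs \<subseteq> G \<Longrightarrow> monom xs \<in> carrier (free_algebra G)"
  by (simp add: monom_def single_closed)

lemma const_mult_single: "const c * Poly_Mapping.single w a = Poly_Mapping.single w (c * a)"
  by (simp add: const_def mult_single flip: zero_word_def)

lemma single_mult_const: "Poly_Mapping.single w a * const c = Poly_Mapping.single w (a * c)"
  by (simp add: const_def mult_single flip: zero_word_def)

text \<open>
  A linear functional on the free algebra.  With \<open>inversion_prod g\<close> as weight it vanishes on the
  relations of a reordering algebra (\<open>weighted_perm_sum_ideal\<close>), so it shows that the ordered monomial
  is not zero in the quotient, without a basis of the algebra being known.
\<close>

definition weighted_perm_sum ::
    "(nat list \<Rightarrow> 'k::field) \<Rightarrow> nat list \<Rightarrow> (nat, 'k) free_poly \<Rightarrow> 'k"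
  where "weighted_perm_sum h J f = (\<Sum>K | mset K = mset J. h K * Poly_Mapping.lookup f (Word K))"

lemma finite_rearrangements: "finite {K. mset K = mset J}"
  by (rule finite_subset[OF _ finite_lists_length_eq[of "set J" "length J"]])
     (auto dest: mset_eq_setD mset_eq_length)

lemma weighted_perm_sum_single:
  "weighted_perm_sum h J (Poly_Mapping.single (Word K) a) = (if mset K = mset J then h K * a else 0)"
proof -
  have "weighted_perm_sum h J (Poly_Mapping.single (Word K) a) =
    (\<Sum>K' | mset K' = mset J. if K' = K then h K * a else 0)"
    unfolding weighted_perm_sum_def by (intro sum.cong) (auto simp: lookup_single when_def)
  then show ?thesis using finite_rearrangements[of J] by (simp add: sum.delta)
qed

lemma weighted_perm_sum_linear:
  "weighted_perm_sum h J 0 = 0"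
  "weighted_perm_sum h J (f + g) = weighted_perm_sum h J f + weighted_perm_sum h J g"
  "weighted_perm_sum h J (- f) = - weighted_perm_sum h J f"
  "weighted_perm_sum h J (f - g) = weighted_perm_sum h J f - weighted_perm_sum h J g"
  by (simp_all add: weighted_perm_sum_def lookup_add lookup_minus distrib_left right_diff_distrib
      sum.distrib sum_negf sum_subtractf)

text \<open>
  The two algebras of reordering factors and the exterior algebra have the same shape: every pair
  of generators commutes up to a factor \<open>g i j\<close>, and there may be relations that kill squares.
\<close>

locale reordering = presentation "{1..n}" R for n :: nat and R :: "(nat, 'k::field) free_poly set" +
  fixes g :: "nat \<Rightarrow> nat \<Rightarrow> 'k"
  assumes swap_rel: "\<And>i j. i \<in> {1..n} \<Longrightarrow> j \<in> {1..n} \<Longrightarrow> i < j \<Longrightarrow>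
      gen i * gen j - const (inverse (g i j)) * gen j * gen i \<in> R"
    and rel_cases: "\<And>\<rho>. \<rho> \<in> R \<Longrightarrow>
      (\<exists>i j. i < j \<and> i \<in> {1..n} \<and> j \<in> {1..n} \<and>
        \<rho> = gen i * gen j - const (inverse (g i j)) * gen j * gen i) \<or>
      (\<exists>i. \<rho> = gen i * gen i)"
    and nonzero: "\<And>i j. i \<in> {1..n} \<Longrightarrow> j \<in> {1..n} \<Longrightarrow> i < j \<Longrightarrow> g i j \<noteq> 0"
begin

lemma inversion_prod_nonzero: "set xs \<subseteq> {1..n} \<Longrightarrow> inversion_prod g xs \<noteq> 0"
proof -
  assume "set xs \<subseteq> {1..n}"
  then have "inversion_prod g xs * inversion_prod (\<lambda>i j. inverse (g i j)) xs = 1"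
    using nonzero by (intro inversion_prod_inverse right_inverse) blast
  then show ?thesis by auto
qed

lemma quot_swap:
  assumes "i \<in> {1..n}" "j \<in> {1..n}" "i < j" "set zs \<subseteq> {1..n}"
  shows "quot {1..n} R (monom (j # i # zs)) = quot {1..n} R (const (g i j) * monom (i # j # zs))"
proof -
  have rel: "gen i * gen j - const (inverse (g i j)) * gen j * gen i \<in> I" (is "?r \<in> I")
    using F.genideal_self[OF rels_closed] swap_rel[OF assms(1-3)] by blast
  \<comment> \<open>The relation writes \<open>x\<^sub>i x\<^sub>j\<close> in terms of \<open>x\<^sub>j x\<^sub>i\<close>; the factor \<open>- g i j\<close> solves it for \<open>x\<^sub>j x\<^sub>i\<close>.\<close>
  have "const (- g i j) * (?r * monom zs) \<in> I"
    using I.I_l_closed[OF I.I_r_closed[OF rel monom_closed[OF assms(4)]] free_algebra_closed(2)]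
    by (simp add: free_algebra_sel)
  also have "const (- g i j) * (?r * monom zs) = monom (j # i # zs) - const (g i j) * monom (i # j # zs)"
    using nonzero[OF assms(1-3)]
    by (simp add: monom_def gen_def const_mult_single single_mult_const mult_single right_diff_distrib left_diff_distrib plus_word_def
         single_uminus)
  finally show ?thesis
    using assms by (subst quot_eq_iff) (simp, intro monom_closed, simp, intro free_algebra_closed monom_closed, simp, assumption)
qed

lemma quot_insort:
  assumes "sorted ys" "x \<in> {1..n}" "set ys \<subseteq> {1..n}"
  shows "quot {1..n} R (monom (x # ys)) =
    quot {1..n} R (const (\<Prod>y\<in>#mset ys. if y < x then g y x else 1) * monom (insort x ys))"
  using assms
proof (induction ys)
  case (Cons y ys)
  show ?case
  proof (cases "x \<le> y")
    case True
    have "(\<Prod>z\<in>#mset (y # ys). if z < x then g z x else 1) = (\<Prod>z\<in>#mset (y # ys). 1)"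
      using True Cons.prems by (intro arg_cong[where f = prod_mset] image_mset_cong) auto
    then have "(\<Prod>z\<in>#mset (y # ys). if z < x then g z x else 1) = 1" by simp
    then show ?thesis using True by (simp add: monom_def const_mult_single del: mset.simps)
  next
    case False
    let ?c = "\<Prod>z\<in>#mset ys. if z < x then g z x else 1"
    have "quot {1..n} R (monom (x # y # ys)) = quot {1..n} R (const (g y x) * gen y) \<otimes>\<^bsub>A\<^esub> quot {1..n} R (monom (x # ys))"
      using Cons.prems False quot_swap[of y x ys]
      by (subst quot_mult) (auto simp: monom_Cons mult.assoc intro!: monom_closed free_algebra_closed)
    also have "\<dots> = quot {1..n} R (const (g y x) * gen y) \<otimes>\<^bsub>A\<^esub> quot {1..n} R (const ?c * monom (insort x ys))"
      using Cons by simp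
    also have "\<dots> = quot {1..n} R (const (g y x) * gen y * (const ?c * monom (insort x ys)))"
      using Cons.prems by (intro quot_mult) (auto simp: set_insort_key intro!: monom_closed free_algebra_closed)
    also have "const (g y x) * gen y * (const ?c * monom (insort x ys)) = const (g y x * ?c) * monom (y # insort x ys)"
      by (simp add: monom_def gen_def const_mult_single mult_single plus_word_def)
    finally show ?thesis using False by simp
  qed
qed (simp add: monom_def const_mult_single)

lemma quot_sort:
  assumes "set xs \<subseteq> {1..n}"
  shows "quot {1..n} R (monom xs) = quot {1..n} R (const (inversion_prod g xs) * monom (sort xs))"
  using assms
proof (induction xs)
  case (Cons x xs)
  let ?c = "\<Prod>y\<in>#mset xs. if y < x then g y x else 1"
  have "quot {1..n} R (monom (x # xs)) = quot {1..n} R (gen x) \<otimes>\<^bsub>A\<^esub> quot {1..n} R (monom xs)"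
    using Cons.prems by (subst quot_mult) (auto simp: monom_Cons intro!: monom_closed free_algebra_closed)
  also have "\<dots> = quot {1..n} R (gen x) \<otimes>\<^bsub>A\<^esub> quot {1..n} R (const (inversion_prod g xs) * monom (sort xs))"
    using Cons by simp
  also have "\<dots> = quot {1..n} R (gen x * (const (inversion_prod g xs) * monom (sort xs)))"
    using Cons.prems by (intro quot_mult) (auto intro!: monom_closed free_algebra_closed)
  also have "gen x * (const (inversion_prod g xs) * monom (sort xs)) = const (inversion_prod g xs) * monom (x # sort xs)"
    by (simp add: monom_def gen_def const_mult_single mult_single plus_word_def)
  also have "quot {1..n} R \<dots> = quot {1..n} R (const (inversion_prod g xs)) \<otimes>\<^bsub>A\<^esub> quot {1..n} R (monom (x # sort xs))"
    using Cons.prems by (intro quot_mult[symmetric]) (auto intro!: monom_closed free_algebra_closed)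
  also have "\<dots> = quot {1..n} R (const (inversion_prod g xs)) \<otimes>\<^bsub>A\<^esub> quot {1..n} R (const ?c * monom (insort x (sort xs)))"
    using Cons.prems quot_insort[of "sort xs" x] by simp
  also have "\<dots> = quot {1..n} R (const (inversion_prod g xs) * (const ?c * monom (insort x (sort xs))))"
    using Cons.prems by (intro quot_mult) (auto simp: set_insort_key intro!: monom_closed free_algebra_closed)
  also have "const (inversion_prod g xs) * (const ?c * monom (insort x (sort xs))) =
    const (inversion_prod g (x # xs)) * monom (sort (x # xs))"
    by (simp add: monom_def const_mult_single mult.commute)
  finally show ?case .
qed (simp add: monom_def const_mult_single)

text \<open>
  Exchanging two neighbouring entries changes the weight by exactly the factor in the
  relation.  A word with a repeated letter is no rearrangement of a list with distinct
  entries, hence squares are killed when \<open>J\<close> is distinct.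
\<close>

lemma weighted_perm_sum_ideal:
  assumes f: "f \<in> I" and J: "distinct J \<or> (\<forall>i. gen i * gen i \<notin> R)"
  shows "weighted_perm_sum (inversion_prod g) J f = 0"
proof (rule rel_ideal_induct[OF f rels_closed])
  fix u v :: "nat word" and a b \<rho>
  assume u: "set (letters u) \<subseteq> {1..n}" and v: "set (letters v) \<subseteq> {1..n}" and \<rho>: "\<rho> \<in> R"
  obtain us vs where uv: "u = Word us" "v = Word vs" by (metis word.exhaust)
  from rel_cases[OF \<rho>]
  show "weighted_perm_sum (inversion_prod g) J (Poly_Mapping.single u a * \<rho> * Poly_Mapping.single v b) = 0"
  proof (elim disjE exE conjE)
    fix i j assume ij: "i < j" "i \<in> {1..n}" "j \<in> {1..n}"
      and \<rho>: "\<rho> = gen i * gen j - const (inverse (g i j)) * gen j * gen i"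
    let ?w = "us @ i # j # vs" and ?w' = "us @ j # i # vs"
    have mset: "mset ?w' = mset ?w" by simp
    have swap: "inversion_prod g ?w' = g i j * inversion_prod g ?w"
      using ij by (simp add: inversion_prod_append add_mset_commute[of j i] mult.left_commute mult.assoc)
    have "Poly_Mapping.single u a * \<rho> * Poly_Mapping.single v b =
      Poly_Mapping.single (Word ?w) (a * b) - Poly_Mapping.single (Word ?w') (a * inverse (g i j) * b)"
      by (simp add: \<rho> uv gen_def const_mult_single mult_single plus_word_def right_diff_distrib left_diff_distrib)
    then show ?thesis
      using nonzero[OF ij(2,3,1)]
      by (simp only: weighted_perm_sum_linear weighted_perm_sum_single mset swap) simp
  next
    fix i assume "\<rho> = gen i * gen i"
    moreover from this have "mset (us @ i # i # vs) \<noteq> mset J"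
      using J \<rho> mset_eq_imp_distinct_iff[of "us @ i # i # vs" J] by auto
    ultimately show ?thesis
      by (simp add: uv gen_def mult_single plus_word_def weighted_perm_sum_single)
  qed
qed (simp_all add: weighted_perm_sum_linear)

text \<open>
  Sorting by adjacent exchanges produces the factor; the functional
  \<open>weighted_perm_sum (inversion_prod g) J\<close> shows that it is the only one.
\<close>

lemma reorder_factor_eq:
  assumes "set J \<subseteq> {1..n}" and J: "distinct J \<or> (\<forall>i. gen i * gen i \<notin> R)"
  shows "reorder_factor n R J = inversion_prod g J"
proof -
  have lhs: "list_prod A (map (presented_gen {1..n} R) J) = quot {1..n} R (monom J)"
    using assms by (intro list_prod_gens) auto
  have rhs: "c \<odot>\<^bsub>A\<^esub> list_prod A (map (presented_gen {1..n} R) (sort J)) =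
      quot {1..n} R (const c * monom (sort J))" for c
    using assms(1) by (subst list_prod_gens) (simp, intro quot_smult monom_closed, simp)
  have "c = inversion_prod g J"
    if "quot {1..n} R (monom J) = quot {1..n} R (const c * monom (sort J))" for c
  proof -
    have "monom J - const c * monom (sort J) \<in> I"
      using that assms by (subst (asm) quot_eq_iff) (auto intro!: monom_closed free_algebra_closed)
    from weighted_perm_sum_ideal[OF this J]
    have "inversion_prod g J * 1 - inversion_prod g (sort J) * c = 0"
      unfolding monom_def const_mult_single weighted_perm_sum_linear weighted_perm_sum_single mset_sort by simp
    then show ?thesis by (simp add: inversion_prod_sorted)
  qed
  then show ?thesis
    unfolding reorder_factor_def Let_def lhs rhs
    using quot_sort[OF assms(1)] inversion_prod_nonzero[OF assms(1)] by (intro the_equality conjI) blast+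
qed

end

text \<open>
  Rules out that a relation of one of the algebras of reordering factors is a square, so that repetitions are
  allowed in the multilabels there.
\<close>

lemma square_not_rel:
  assumes "i < j"
  shows "gen k * gen k \<noteq> (gen i * gen j - const c * gen j * gen i :: (nat, 'k::field) free_poly)"
proof
  assume "gen k * gen k = (gen i * gen j - const c * gen j * gen i :: (nat, 'k) free_poly)"
  then have "Poly_Mapping.lookup (gen k * gen k :: (nat, 'k) free_poly) (Word [i, j]) =
    Poly_Mapping.lookup (gen i * gen j - const c * gen j * gen i) (Word [i, j])" by simp
  then show False
    using assms by (simp add: gen_def const_mult_single mult_single plus_word_def lookup_minus lookup_single when_def split: if_splits)
qed

lemma Sr_rels_alt:
  "Sr_rels n q Q =
    {gen i * gen j - const (inverse (Q i j / q)) * gen j * gen i | i j.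
       i \<in> {1..n} \<and> j \<in> {1..n} \<and> i < j}"
proof -
  have "inverse (Q i j / q) = q * inverse (Q i j)" for i j by (metis inverse_divide divide_inverse)
  then show ?thesis by (simp only: Sr_rels_def)
qed

lemma zeta_r_eq:
  assumes "set J \<subseteq> {1..n}" "q \<noteq> 0" and Q: "\<And>i j. i \<in> {1..n} \<Longrightarrow> j \<in> {1..n} \<Longrightarrow> Q i j \<noteq> 0"
  shows "zeta_r n q Q J = inversion_prod (\<lambda>i j. Q i j / q) J"
proof -
  interpret reordering n "Sr_rels n q Q" "\<lambda>i j. Q i j / q"
  proof unfold_locales
    show "Sr_rels n q Q \<subseteq> carrier (free_algebra {1..n})" by (rule Sr_rels_closed)
  next
    fix i j assume "i \<in> {1..n}" "j \<in> {1..n}"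
    then show "Q i j / q \<noteq> 0" using assms by simp
  qed (unfold Sr_rels_alt, blast+)
  show ?thesis
    unfolding zeta_r_def using assms(1)
    by (intro reorder_factor_eq) (auto simp: Sr_rels_def square_not_rel)
qed

lemma Sl_rels_alt:
  "Sl_rels n q Q =
    {gen i * gen j - const (inverse (q / Q i j)) * gen j * gen i | i j.
       i \<in> {1..n} \<and> j \<in> {1..n} \<and> i < j}"
proof -
  have "inverse (q / Q i j) = Q i j * inverse q" for i j by (metis inverse_divide divide_inverse)
  then show ?thesis by (simp only: Sl_rels_def)
qed

lemma zeta_l_eq:
  assumes "set J \<subseteq> {1..n}" "q \<noteq> 0" and Q: "\<And>i j. i \<in> {1..n} \<Longrightarrow> j \<in> {1..n} \<Longrightarrow> Q i j \<noteq> 0"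
  shows "zeta_l n q Q J = inversion_prod (\<lambda>i j. q / Q i j) J"
proof -
  interpret reordering n "Sl_rels n q Q" "\<lambda>i j. q / Q i j"
  proof unfold_locales
    show "Sl_rels n q Q \<subseteq> carrier (free_algebra {1..n})" by (rule Sl_rels_closed)
  next
    fix i j assume "i \<in> {1..n}" "j \<in> {1..n}"
    then show "q / Q i j \<noteq> 0" using assms by simp
  qed (unfold Sl_rels_alt, blast+)
  show ?thesis
    unfolding zeta_l_def using assms(1)
    by (intro reorder_factor_eq) (auto simp: Sl_rels_def square_not_rel)
qed

lemma Lambda_rels_alt:
  fixes P :: "nat \<Rightarrow> nat \<Rightarrow> 'k::field"
  shows "Lambda_rels n P =
    {gen i * gen j - const (inverse (- P i j)) * gen j * gen i | i j.
       i \<in> {1..n} \<and> j \<in> {1..n} \<and> i < j} \<union> {gen i * gen i | i. i \<in> {1..n}}"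
proof -
  have "x - const (inverse (- c)) * y * z = x + const (inverse c) * y * z"
    for c :: 'k and x y z :: "(nat, 'k) free_poly"
    unfolding inverse_minus_eq const_def single_uminus by simp
  then show ?thesis by (simp only: Lambda_rels_def)
qed

lemma eps_eq:
  assumes "set J \<subseteq> {1..n}" "distinct J" and P: "\<And>i j. i \<in> {1..n} \<Longrightarrow> j \<in> {1..n} \<Longrightarrow> P i j \<noteq> 0"
  shows "eps n P J = inversion_prod (\<lambda>i j. - P i j) J"
proof -
  interpret reordering n "Lambda_rels n P" "\<lambda>i j. - P i j"
  proof unfold_locales
    show "Lambda_rels n P \<subseteq> carrier (free_algebra {1..n})" by (rule Lambda_rels_closed)
  qed (use P in \<open>unfold Lambda_rels_alt neg_equal_0_iff_equal, blast+\<close>)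
  show ?thesis
    unfolding eps_def using assms by (intro reorder_factor_eq) auto
qed

section \<open>Twisting the free algebra by the weight of a word\<close>

text \<open>
  The diagonal linear map scaling each word.  For the weights below it is not an algebra
  homomorphism, but on homogeneous elements it is multiplicative up to a scalar.
\<close>

definition twist :: "('g word \<Rightarrow> 'k) \<Rightarrow> ('g, 'k::field) free_poly \<Rightarrow> ('g, 'k) free_poly"
  where "twist \<chi> f = (\<Sum>w\<in>Poly_Mapping.keys f. Poly_Mapping.single w (\<chi> w * Poly_Mapping.lookup f w))"

lemma lookup_twist: "Poly_Mapping.lookup (twist \<chi> f) w = \<chi> w * Poly_Mapping.lookup f w"
  by (auto simp: twist_def lookup_sum lookup_single when_def sum.delta in_keys_iff)

lemma twist_linear:
  "twist \<chi> 0 = 0" "twist \<chi> (f + g) = twist \<chi> f + twist \<chi> g" "twist \<chi> (- f) = - twist \<chi> f"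
  "twist \<chi> (f - g) = twist \<chi> f - twist \<chi> g"
  "twist \<chi> (\<Sum>i\<in>X. h i) = (\<Sum>i\<in>X. twist \<chi> (h i))"
  by (rule poly_mapping_eqI; simp add: lookup_twist lookup_add lookup_minus lookup_sum
      distrib_left right_diff_distrib sum_distrib_left)+

lemma twist_single: "twist \<chi> (Poly_Mapping.single w c) = Poly_Mapping.single w (\<chi> w * c)"
  by (rule poly_mapping_eqI) (simp add: lookup_twist lookup_single when_def)

lemma twist_twist: "twist \<chi> (twist \<psi> f) = twist (\<lambda>w. \<chi> w * \<psi> w) f"
  by (rule poly_mapping_eqI) (simp add: lookup_twist mult.assoc)

lemma twist_trivial:
  assumes "\<And>w. w \<in> Poly_Mapping.keys f \<Longrightarrow> \<chi> w = 1"
  shows "twist \<chi> f = f"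
proof (rule poly_mapping_eqI)
  fix w show "Poly_Mapping.lookup (twist \<chi> f) w = Poly_Mapping.lookup f w"
    using assms[of w] by (cases "w \<in> Poly_Mapping.keys f") (auto simp: lookup_twist in_keys_iff)
qed

lemma const_commute: "f * const c = const c * f"
proof -
  have "(\<Sum>w\<in>Poly_Mapping.keys f. Poly_Mapping.single w (Poly_Mapping.lookup f w)) * const c =
    const c * (\<Sum>w\<in>Poly_Mapping.keys f. Poly_Mapping.single w (Poly_Mapping.lookup f w))"
    by (simp add: sum_distrib_left sum_distrib_right const_mult_single single_mult_const mult.commute)
  then show ?thesis by (simp flip: free_poly_expand)
qed

lemma const_mult: "const (c * d) = const c * const d"
  by (simp add: const_def mult_single flip: zero_word_def)

lemma lookup_const_mult: "Poly_Mapping.lookup (const c * f) w = c * Poly_Mapping.lookup f w"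
proof -
  have "const c * f = twist (\<lambda>_. c) f"
    by (subst free_poly_expand[of f]) (simp add: twist_def sum_distrib_left const_mult_single)
  then show ?thesis by (simp add: lookup_twist)
qed

lemma twist_const_mult: "twist \<chi> (const c * f) = const c * twist \<chi> f"
  by (rule poly_mapping_eqI) (simp add: lookup_twist lookup_const_mult mult.left_commute)

definition row_label :: "(nat \<times> nat) word \<Rightarrow> nat list" where "row_label w = map fst (letters w)"
definition col_label :: "(nat \<times> nat) word \<Rightarrow> nat list" where "col_label w = map snd (letters w)"

lemma label_plus:
  "row_label (u + v) = row_label u @ row_label v" "col_label (u + v) = col_label u @ col_label v"
  by (simp_all add: row_label_def col_label_def)

definition reorder_weight :: "(nat \<Rightarrow> nat \<Rightarrow> 'k) \<Rightarrow> (nat \<Rightarrow> nat \<Rightarrow> 'k) \<Rightarrow> (nat \<times> nat) word \<Rightarrow> 'k::field"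
  where "reorder_weight a b w = inversion_prod a (row_label w) * inversion_prod b (col_label w)"

definition homogeneous :: "nat multiset \<Rightarrow> nat multiset \<Rightarrow> (nat \<times> nat, 'k::field) free_poly \<Rightarrow> bool"
  where "homogeneous A B f \<longleftrightarrow>
    (\<forall>w\<in>Poly_Mapping.keys f. mset (row_label w) = A \<and> mset (col_label w) = B)"

lemma homogeneous_single:
  "mset (row_label w) = A \<Longrightarrow> mset (col_label w) = B \<Longrightarrow> homogeneous A B (Poly_Mapping.single w c)"
  by (simp add: homogeneous_def)

lemma homogeneous_diff: "homogeneous A B f \<Longrightarrow> homogeneous A B g \<Longrightarrow> homogeneous A B (f - g)"
  using keys_diff[of f g] unfolding homogeneous_def by blast

lemma homogeneous_mult: "homogeneous A B f \<Longrightarrow> homogeneous C D g \<Longrightarrow> homogeneous (A + C) (B + D) (f * g)"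
proof (unfold homogeneous_def, rule ballI)
  fix w
  assume f: "\<forall>w\<in>Poly_Mapping.keys f. mset (row_label w) = A \<and> mset (col_label w) = B"
    and g: "\<forall>w\<in>Poly_Mapping.keys g. mset (row_label w) = C \<and> mset (col_label w) = D"
    and "w \<in> Poly_Mapping.keys (f * g)"
  then obtain u v where "w = u + v" "u \<in> Poly_Mapping.keys f" "v \<in> Poly_Mapping.keys g"
    using keys_mult[of f g] by blast
  then show "mset (row_label w) = A + C \<and> mset (col_label w) = B + D"
    using f g by (simp add: label_plus)
qed

lemma homogeneous_add: "homogeneous A B f \<Longrightarrow> homogeneous A B g \<Longrightarrow> homogeneous A B (f + g)"
  using Poly_Mapping.keys_add[of f g] unfolding homogeneous_def by blast

lemma homogeneous_zero: "homogeneous A B 0"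
  by (simp add: homogeneous_def)

lemma homogeneous_sum:
  "(\<And>i. i \<in> X \<Longrightarrow> homogeneous A B (h i)) \<Longrightarrow> homogeneous A B (\<Sum>i\<in>X. h i)"
  by (induction X rule: infinite_finite_induct) (simp_all add: homogeneous_zero homogeneous_add)

text \<open>
  The weight of a concatenation differs from the product of the weights by the factors for
  inversions between the two parts, and these depend only on the row and column multisets.
\<close>

lemma twist_mult:
  assumes "homogeneous A B f" "homogeneous C D g"
  shows "twist (reorder_weight a b) (f * g) =
    const (cross_prod a A C * cross_prod b B D) * (twist (reorder_weight a b) f * twist (reorder_weight a b) g)"
proof -
  let ?\<chi> = "reorder_weight a b" and ?k = "cross_prod a A C * cross_prod b B D"
  let ?f = "Poly_Mapping.lookup f" and ?g = "Poly_Mapping.lookup g"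
  have weight: "?\<chi> (u + v) = ?k * (?\<chi> u * ?\<chi> v)"
    if "u \<in> Poly_Mapping.keys f" "v \<in> Poly_Mapping.keys g" for u v
    using assms that by (simp add: homogeneous_def reorder_weight_def label_plus inversion_prod_append)
  have "f * g = (\<Sum>u\<in>Poly_Mapping.keys f. \<Sum>v\<in>Poly_Mapping.keys g. Poly_Mapping.single (u + v) (?f u * ?g v))"
    by (subst free_poly_expand[of f], subst free_poly_expand[of g]) (simp add: sum_product mult_single)
  then have "twist ?\<chi> (f * g) =
    (\<Sum>u\<in>Poly_Mapping.keys f. \<Sum>v\<in>Poly_Mapping.keys g. Poly_Mapping.single (u + v) (?\<chi> (u + v) * (?f u * ?g v)))"
    by (simp only: twist_linear twist_single)
  also have "\<dots> = (\<Sum>u\<in>Poly_Mapping.keys f. \<Sum>v\<in>Poly_Mapping.keys g.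
      Poly_Mapping.single (u + v) (?k * ((?\<chi> u * ?f u) * (?\<chi> v * ?g v))))"
    by (intro sum.cong refl) (simp add: weight mult_ac)
  also have "\<dots> = const ?k * (twist ?\<chi> f * twist ?\<chi> g)"
    unfolding twist_def sum_product mult_single
    unfolding sum_distrib_left const_mult_single ..
  finally show ?thesis .
qed

lemma twist_closed: "f \<in> carrier (free_algebra G) \<Longrightarrow> twist \<chi> f \<in> carrier (free_algebra G)"
  unfolding twist_def by (intro sum_closed single_closed) (auto simp: free_algebra_def)

text \<open>
  Because the twist of \<open>u * \<rho> * v\<close> is a scalar times the product of the twists, it suffices to
  compare the relations.
\<close>

lemma twist_rel_ideal:
  fixes R R' :: "(nat \<times> nat, 'k::field) free_poly set"
  assumes R: "R \<subseteq> carrier (free_algebra G)" and R': "R' \<subseteq> carrier (free_algebra G)"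
    and hom: "\<And>\<rho>. \<rho> \<in> R \<Longrightarrow> \<exists>A B. homogeneous A B \<rho>"
    and rel: "\<And>\<rho>. \<rho> \<in> R \<Longrightarrow> twist (reorder_weight a b) \<rho> \<in> R'"
    and f: "f \<in> rel_ideal G R"
  shows "twist (reorder_weight a b) f \<in> rel_ideal G R'"
proof (rule rel_ideal_induct[OF f R])
  interpret R': presentation G R' by unfold_locales (rule R')
  show "twist (reorder_weight a b) 0 \<in> rel_ideal G R'"
    using R'.I.zero_closed by (simp add: twist_linear free_algebra_sel)
  show "twist (reorder_weight a b) (f + g) \<in> rel_ideal G R'"
    if "twist (reorder_weight a b) f \<in> rel_ideal G R'" "twist (reorder_weight a b) g \<in> rel_ideal G R'" for f g
    using R'.I.a_closed[OF that] by (simp add: twist_linear free_algebra_sel)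
  show "twist (reorder_weight a b) (- f) \<in> rel_ideal G R'"
    if "twist (reorder_weight a b) f \<in> rel_ideal G R'" for f
    using R'.I.a_inv_closed[OF that] R'.I.a_Hcarr[OF that] by (simp add: twist_linear a_inv_free)
  fix u v :: "(nat \<times> nat) word" and c d :: 'k and \<rho>
  assume u: "set (letters u) \<subseteq> G" and v: "set (letters v) \<subseteq> G" and \<rho>: "\<rho> \<in> R"
  let ?u = "Poly_Mapping.single u c" and ?v = "Poly_Mapping.single v d"
  obtain A B where AB: "homogeneous A B \<rho>" using hom[OF \<rho>] by blast
  obtain k l where twist: "twist (reorder_weight a b) (?u * \<rho> * ?v) =
    const k * (const l * (twist (reorder_weight a b) ?u * twist (reorder_weight a b) \<rho>) * twist (reorder_weight a b) ?v)"
    using twist_mult[OF homogeneous_mult[OF homogeneous_single[OF refl refl] AB] homogeneous_single[OF refl refl], of a b u c v d]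
    unfolding twist_mult[OF homogeneous_single[OF refl refl] AB] by (rule that)
  have "twist (reorder_weight a b) \<rho> \<in> rel_ideal G R'"
    using rel[OF \<rho>] R'.F.genideal_self[OF R'] by blast
  then have "twist (reorder_weight a b) ?u * twist (reorder_weight a b) \<rho> \<in> rel_ideal G R'"
    using R'.I.I_l_closed[OF _ twist_closed[OF single_closed[OF u]]] by (simp add: free_algebra_sel)
  then have "const l * (twist (reorder_weight a b) ?u * twist (reorder_weight a b) \<rho>) \<in> rel_ideal G R'"
    using R'.I.I_l_closed[OF _ free_algebra_closed(2)] by (simp add: free_algebra_sel)
  then have "const l * (twist (reorder_weight a b) ?u * twist (reorder_weight a b) \<rho>) * twist (reorder_weight a b) ?v \<in> rel_ideal G R'"
    using R'.I.I_r_closed[OF _ twist_closed[OF single_closed[OF v]]] by (simp add: free_algebra_sel)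
  then show "twist (reorder_weight a b) (?u * \<rho> * ?v) \<in> rel_ideal G R'"
    unfolding twist using R'.I.I_l_closed[OF _ free_algebra_closed(2)] by (simp add: free_algebra_sel)
qed

lemma gen_products:
  "gen x * gen y = Poly_Mapping.single (Word [x, y]) 1"
  "const c * gen x * gen y = Poly_Mapping.single (Word [x, y]) c"
  by (simp_all add: gen_def const_mult_single mult_single plus_word_def)

lemma qmatrix_rels_homogeneous: "\<rho> \<in> qmatrix_rels n P Q \<Longrightarrow> \<exists>A B. homogeneous A B \<rho>"
  unfolding qmatrix_rels_def gen_products
proof (elim UnE CollectE exE conjE, goal_cases)
  case (1 i j k)
  show ?case unfolding 1(1)
    by (rule exI[of _ "{#k, k#}"], rule exI[of _ "{#i, j#}"], intro homogeneous_diff homogeneous_single)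
       (simp_all add: row_label_def col_label_def)
next
  case (2 i k l)
  show ?case unfolding 2(1)
    by (rule exI[of _ "{#k, l#}"], rule exI[of _ "{#i, i#}"], intro homogeneous_diff homogeneous_single)
       (simp_all add: row_label_def col_label_def)
next
  case (3 i j k l)
  show ?case unfolding 3(1)
    by (rule exI[of _ "{#k, l#}"], rule exI[of _ "{#i, j#}"], intro homogeneous_diff homogeneous_single)
       (simp_all add: row_label_def col_label_def)
next
  case (4 i j k l)
  show ?case unfolding 4(1)
    by (rule exI[of _ "{#k, l#}"], rule exI[of _ "{#i, j#}"], intro homogeneous_diff homogeneous_single)
       (simp_all add: row_label_def col_label_def)
qed

lemma reorder_weight_pair:
  "reorder_weight a b (Word [(k, i), (l, j)]) = (if l < k then a l k else 1) * (if j < i then b j i else 1)"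
  by (simp add: reorder_weight_def row_label_def col_label_def)

text \<open>
  The computation behind the theorem.  A column inversion contributes \<open>b\<close> and a row inversion
  its inverse \<open>a\<close>; the relations of the quantum matrix algebra go to those with \<open>Q\<close>
  multiplied and \<open>P\<close> divided by \<open>b\<close>.  Choosing the two weights inverse to each other is forced by
  the coefficient \<open>q\<^sub>i\<^sub>j / q\<^sub>k\<^sub>l\<close> of the last relation, whose first two monomials differ by one row and one
  column inversion.
\<close>

lemma twist_qmatrix_rels:
  assumes b: "\<And>i j. i \<in> {1..n} \<Longrightarrow> j \<in> {1..n} \<Longrightarrow> i < j \<Longrightarrow> b i j \<noteq> 0"
    and a: "\<And>i j. i \<in> {1..n} \<Longrightarrow> j \<in> {1..n} \<Longrightarrow> i < j \<Longrightarrow> a i j = inverse (b i j)"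
    and Q: "\<And>i j. i \<in> {1..n} \<Longrightarrow> j \<in> {1..n} \<Longrightarrow> i < j \<Longrightarrow> Q' i j = b i j * Q i j"
    and P: "\<And>i j. i \<in> {1..n} \<Longrightarrow> j \<in> {1..n} \<Longrightarrow> i < j \<Longrightarrow> P' i j = a i j * P i j"
    and \<rho>: "\<rho> \<in> qmatrix_rels n P Q"
  shows "twist (reorder_weight a b) \<rho> \<in> qmatrix_rels n P' Q'"
  using \<rho> unfolding qmatrix_rels_def gen_products
proof (elim UnE CollectE exE conjE, goal_cases)
  case (1 i j k)
  then have "twist (reorder_weight a b) \<rho> =
    Poly_Mapping.single (Word [(k, i), (k, j)]) 1 - Poly_Mapping.single (Word [(k, j), (k, i)]) (Q' i j)"
    by (simp add: twist_linear twist_single reorder_weight_pair Q)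
  then show ?case
    by (simp only:) (rule UnI1, rule UnI1, rule UnI1, rule CollectI, intro exI conjI, rule refl, (rule 1)+)
next
  case (2 i k l)
  then have "twist (reorder_weight a b) \<rho> =
    Poly_Mapping.single (Word [(k, i), (l, i)]) 1 - Poly_Mapping.single (Word [(l, i), (k, i)]) (P' k l)"
    by (simp add: twist_linear twist_single reorder_weight_pair P)
  then show ?case
    by (simp only:) (rule UnI1, rule UnI1, rule UnI2, rule CollectI, intro exI conjI, rule refl, (rule 2)+)
next
  case (3 i j k l)
  then have "twist (reorder_weight a b) \<rho> =
    Poly_Mapping.single (Word [(k, j), (l, i)]) (Q' i j) - Poly_Mapping.single (Word [(l, i), (k, j)]) (P' k l)"
    by (simp add: twist_linear twist_single reorder_weight_pair P Q)
  then show ?case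
    by (simp only:) (rule UnI1, rule UnI2, rule CollectI, intro exI conjI, rule refl, (rule 3)+)
next
  case (4 i j k l)
  have "b i j * (Q i j - inverse (P i j)) = Q' i j - inverse (P' i j)"
    using 4 b[of i j] by (simp add: P Q a right_diff_distrib)
  moreover have "a k l * b i j * (Q i j * inverse (Q k l)) = Q' i j * inverse (Q' k l)"
    using 4 by (simp add: Q a)
  ultimately have "twist (reorder_weight a b) \<rho> =
    Poly_Mapping.single (Word [(k, i), (l, j)]) 1
      - Poly_Mapping.single (Word [(l, j), (k, i)]) (Q' i j * inverse (Q' k l))
      - Poly_Mapping.single (Word [(k, j), (l, i)]) (Q' i j - inverse (P' i j))"
    using 4 by (simp add: twist_linear twist_single reorder_weight_pair)
  then show ?case
    by (simp only:) (rule UnI2, rule CollectI, intro exI conjI, rule refl, (rule 4)+)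
qed

section \<open>Products of quantum minors and their twists\<close>

text \<open>
  A lift of a quantum minor to the free algebra, with the sign of a rearranged row label left
  open: \<open>- q\<close> or \<open>- P\<close> per inversion gives the two kinds of minors.
\<close>

definition minor_poly :: "(nat list \<Rightarrow> 'k) \<Rightarrow> nat list \<Rightarrow> nat list \<Rightarrow> (nat \<times> nat, 'k::field) free_poly"
  where "minor_poly h K L = (\<Sum>\<sigma> | \<sigma> permutes {..<length K}.
    Poly_Mapping.single (Word (zip (permute_list \<sigma> K) L)) (h (permute_list \<sigma> K)))"

definition minor_word_poly ::
    "(nat list \<Rightarrow> 'k) \<Rightarrow> (nat list \<times> nat list) list \<Rightarrow> (nat \<times> nat, 'k::field) free_poly"
  where "minor_word_poly h w = prod_list (map (\<lambda>(K, L). minor_poly h K L) w)"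

lemma labels_zip:
  assumes "\<sigma> permutes {..<length K}" "length K = length L"
  shows "row_label (Word (zip (permute_list \<sigma> K) L)) = permute_list \<sigma> K"
    "col_label (Word (zip (permute_list \<sigma> K) L)) = L"
  using assms by (simp_all add: row_label_def col_label_def)

lemma minor_poly_homogeneous:
  assumes "length K = length L"
  shows "homogeneous (mset K) (mset L) (minor_poly h K L)"
  unfolding minor_poly_def
  using assms by (intro homogeneous_sum homogeneous_single) (simp_all add: labels_zip)

lemma minor_word_poly_homogeneous:
  assumes "\<And>K L. (K, L) \<in> set w \<Longrightarrow> length K = length L"
  shows "homogeneous (mset (rows w)) (mset (cols w)) (minor_word_poly h w)"
  using assms
proof (induction w)
  case Nil
  have "homogeneous {#} {#} (Poly_Mapping.single 0 1)"
    by (rule homogeneous_single) (simp_all add: row_label_def col_label_def)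
  then show ?case by (simp add: minor_word_poly_def rows_def cols_def)
next
  case (Cons KL w)
  obtain K L where KL: "KL = (K, L)" by (cases KL)
  have "homogeneous (mset K + mset (rows w)) (mset L + mset (cols w)) (minor_poly h K L * minor_word_poly h w)"
    using Cons.prems by (intro homogeneous_mult minor_poly_homogeneous Cons.IH) (simp_all add: KL)
  then show ?case by (simp add: KL minor_word_poly_def rows_def cols_def)
qed

lemma twist_minor_poly:
  assumes "length K = length L" "sorted L"
  shows "twist (reorder_weight a b) (minor_poly h K L) = minor_poly (\<lambda>J. inversion_prod a J * h J) K L"
  unfolding minor_poly_def twist_linear twist_single
  using assms by (intro sum.cong refl) (simp add: reorder_weight_def labels_zip inversion_prod_sorted)

text \<open>
  Since \<open>K\<close> and \<open>L\<close> are sorted in each factor, all inversions of the total row and column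
  labels of \<open>w\<close> run between different factors.  These contribute a constant, whereas the
  inversions inside a rearrangement of \<open>K\<close> change the sign of the corresponding term.
\<close>

lemma twist_minor_word_poly:
  assumes "\<And>K L. (K, L) \<in> set w \<Longrightarrow> length K = length L \<and> sorted K \<and> sorted L"
  shows "twist (reorder_weight a b) (minor_word_poly h w) =
    const (inversion_prod a (rows w) * inversion_prod b (cols w)) * minor_word_poly (\<lambda>J. inversion_prod a J * h J) w"
  using assms
proof (induction w)
  case Nil
  have "reorder_weight a b 0 = 1" by (simp add: reorder_weight_def row_label_def col_label_def)
  then have "twist (reorder_weight a b) (Poly_Mapping.single 0 1) = Poly_Mapping.single 0 1"
    by (simp only: twist_single mult_1)
  then show ?case
    by (simp add: minor_word_poly_def rows_def cols_def const_def flip: zero_word_def)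
next
  case (Cons KL w)
  obtain K L where KL: "KL = (K, L)" by (cases KL)
  let ?h = "\<lambda>J. inversion_prod a J * h J"
  let ?cross = "cross_prod a (mset K) (mset (rows w)) * cross_prod b (mset L) (mset (cols w))"
  let ?c = "inversion_prod a (rows w) * inversion_prod b (cols w)"
  have KL_props: "length K = length L" "sorted K" "sorted L"
    using Cons.prems[of K L] by (simp_all add: KL)
  have len: "\<And>K L. (K, L) \<in> set w \<Longrightarrow> length K = length L"
    using Cons.prems by simp
  have IH: "twist (reorder_weight a b) (minor_word_poly h w) = const ?c * minor_word_poly ?h w"
    by (rule Cons.IH, rule Cons.prems) simp
  have swap: "minor_poly ?h K L * (const d * f) = const d * (minor_poly ?h K L * f)" for d f
    by (metis const_commute mult.assoc)
  have factor: "inversion_prod a (rows (KL # w)) * inversion_prod b (cols (KL # w)) = ?cross * ?c"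
    by (simp add: KL rows_def cols_def inversion_prod_append inversion_prod_sorted KL_props)
  have "twist (reorder_weight a b) (minor_word_poly h (KL # w)) =
    twist (reorder_weight a b) (minor_poly h K L * minor_word_poly h w)"
    by (simp add: KL minor_word_poly_def)
  also have "\<dots> = const ?cross * (minor_poly ?h K L * (const ?c * minor_word_poly ?h w))"
    by (simp only: IH twist_mult[OF minor_poly_homogeneous[OF KL_props(1)] minor_word_poly_homogeneous[OF len]]
        twist_minor_poly[OF KL_props(1,3)])
  also have "\<dots> = const (?cross * ?c) * (minor_poly ?h K L * minor_word_poly ?h w)"
    by (simp only: const_mult mult.assoc swap)
  finally show ?case unfolding factor by (simp add: KL minor_word_poly_def)
qed

lemma minor_poly_cong:
  assumes "\<And>J. mset J = mset K \<Longrightarrow> h J = h' J"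
  shows "minor_poly h K L = minor_poly h' K L"
  unfolding minor_poly_def using assms by (intro sum.cong refl) simp

lemma presentation_qmatrix: "presentation (qmatrix_gens n) (qmatrix_rels n P Q)"
  by unfold_locales (rule qmatrix_rels_closed)

lemma zip_permute_list_gens:
  assumes KL: "set K \<subseteq> {1..n}" "set L \<subseteq> {1..n}" and \<sigma>: "\<sigma> permutes {..<length K}"
  shows "set (zip (permute_list \<sigma> K) L) \<subseteq> qmatrix_gens n"
proof
  fix x assume x: "x \<in> set (zip (permute_list \<sigma> K) L)"
  obtain i j where ij: "x = (i, j)" by (cases x)
  have "i \<in> set K" using set_zip_leftD[OF x[unfolded ij]] \<sigma> by simp
  moreover have "j \<in> set L" using set_zip_rightD[OF x[unfolded ij]] .
  ultimately show "x \<in> qmatrix_gens n"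
    using KL unfolding ij qmatrix_gens_def by blast
qed

lemma minor_poly_closed:
  assumes "set K \<subseteq> {1..n}" "set L \<subseteq> {1..n}"
  shows "minor_poly h K L \<in> carrier (free_algebra (qmatrix_gens n))"
  unfolding minor_poly_def
  using zip_permute_list_gens[OF assms] by (intro sum_closed single_closed) simp

lemma minor_sum_quot:
  fixes P Q :: "nat \<Rightarrow> nat \<Rightarrow> 'k::field"
  assumes KL: "set K \<subseteq> {1..n}" "set L \<subseteq> {1..n}"
    and c: "\<And>\<sigma>. \<sigma> permutes {..<length K} \<Longrightarrow> c \<sigma> = h (permute_list \<sigma> K)"
  shows "(\<Oplus>\<^bsub>qmatrix_algebra n P Q\<^esub>\<sigma> \<in> {\<sigma>. \<sigma> permutes {..<length K}}.
      c \<sigma> \<odot>\<^bsub>qmatrix_algebra n P Q\<^esub>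
        list_prod (qmatrix_algebra n P Q) (map2 (qmatrix_T n P Q) (permute_list \<sigma> K) L)) =
    quot (qmatrix_gens n) (qmatrix_rels n P Q) (minor_poly h K L)"
proof -
  let ?A = "presented_algebra (qmatrix_gens n) (qmatrix_rels n P Q)"
  let ?q = "quot (qmatrix_gens n) (qmatrix_rels n P Q)"
  let ?m = "\<lambda>\<sigma>. Poly_Mapping.single (Word (zip (permute_list \<sigma> K) L)) (h (permute_list \<sigma> K))"
  interpret qmatrix: presentation "qmatrix_gens n" "qmatrix_rels n P Q"
    by (rule presentation_qmatrix)
  interpret A: abelian_monoid ?A by (rule qmatrix.abelian_monoid_A)
  note gens = zip_permute_list_gens[OF KL]
  have "qmatrix_T n P Q i j = presented_gen (qmatrix_gens n) (qmatrix_rels n P Q) (i, j)" for i j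
    by (simp add: qmatrix_T_def)
  then have T: "map2 (qmatrix_T n P Q) xs ys = map (presented_gen (qmatrix_gens n) (qmatrix_rels n P Q)) (zip xs ys)" for xs ys
    by (intro map_cong) auto
  have summand: "c \<sigma> \<odot>\<^bsub>?A\<^esub> list_prod ?A (map2 (qmatrix_T n P Q) (permute_list \<sigma> K) L) = ?q (?m \<sigma>)"
    if "\<sigma> permutes {..<length K}" for \<sigma>
    using gens[OF that] c[OF that]
    by (simp only: T qmatrix.list_prod_gens qmatrix.quot_smult monom_closed)
       (simp add: monom_def const_mult_single)
  have "finsum ?A (\<lambda>\<sigma>. c \<sigma> \<odot>\<^bsub>?A\<^esub> list_prod ?A (map2 (qmatrix_T n P Q) (permute_list \<sigma> K) L)) {\<sigma>. \<sigma> permutes {..<length K}} =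
    finsum ?A (\<lambda>\<sigma>. ?q (?m \<sigma>)) {\<sigma>. \<sigma> permutes {..<length K}}"
    using gens by (intro A.finsum_cong') (simp_all add: summand qmatrix.quot_closed single_closed)
  also have "\<dots> = ?q (minor_poly h K L)"
    unfolding minor_poly_def
    using gens by (intro qmatrix.finsum_quot finite_permutations) (simp_all add: single_closed)
  finally show ?thesis by (simp only: qmatrix_algebra_def)
qed

lemma D_minor_quot:
  assumes P: "\<And>i j. i \<in> {1..n} \<Longrightarrow> j \<in> {1..n} \<Longrightarrow> P i j \<noteq> 0"
    and KL: "set K \<subseteq> {1..n}" "set L \<subseteq> {1..n}" and K: "distinct K"
  shows "D_minor n P Q K L =
    quot (qmatrix_gens n) (qmatrix_rels n P Q) (minor_poly (inversion_prod (\<lambda>i j. - P i j)) K L)"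
  unfolding D_minor_def Let_def
proof (rule minor_sum_quot[OF KL])
  fix \<sigma> assume \<sigma>: "\<sigma> permutes {..<length K}"
  show "eps n P (permute_list \<sigma> K) = inversion_prod (\<lambda>i j. - P i j) (permute_list \<sigma> K)"
    using KL K \<sigma> by (intro eps_eq P) simp_all
qed

text \<open>
  A strictly increasing label turns inversions of entries into inversions of positions.
\<close>

lemma inversion_prod_permute_list:
  fixes c :: "'k::comm_monoid_mult"
  assumes K: "sorted_wrt (<) K" and \<sigma>: "\<sigma> permutes {..<length K}"
  shows "inversion_prod (\<lambda>i j. c) (permute_list \<sigma> K) = c ^ inversion_number (length K) \<sigma>"
proof -
  have less: "permute_list \<sigma> K ! b < permute_list \<sigma> K ! a \<longleftrightarrow> \<sigma> b < \<sigma> a"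
    if "a < length K" "b < length K" for a b
  proof -
    have "\<sigma> a < length K" "\<sigma> b < length K"
      using that permutes_in_image[OF \<sigma>] by (metis lessThan_iff)+
    then have "K ! \<sigma> b < K ! \<sigma> a \<longleftrightarrow> \<sigma> b < \<sigma> a"
      using sorted_wrt_nth_less[OF K] by (metis less_asym linorder_less_linear)
    then show ?thesis using that \<sigma> by (simp add: permute_list_nth)
  qed
  have "{(a, b). a < b \<and> b < length (permute_list \<sigma> K) \<and> permute_list \<sigma> K ! b < permute_list \<sigma> K ! a} =
    {(a, b). a < b \<and> b < length K \<and> \<sigma> a > \<sigma> b}"
    using less by auto
  then show ?thesis by (simp only: inversion_prod_const inversion_number_def)
qed

lemma d_minor_quot:
  assumes KL: "set K \<subseteq> {1..n}" "set L \<subseteq> {1..n}" and K: "sorted_wrt (<) K"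
  shows "d_minor n q K L =
    quot (qmatrix_gens n) (qmatrix_rels n (one_param q) (one_param q)) (minor_poly (inversion_prod (\<lambda>i j. - q)) K L)"
  unfolding d_minor_def Let_def
proof (rule minor_sum_quot[OF KL])
  fix \<sigma> assume \<sigma>: "\<sigma> permutes {..<length K}"
  show "(- q) ^ inversion_number (length K) \<sigma> = inversion_prod (\<lambda>i j. - q) (permute_list \<sigma> K)"
    using K \<sigma> by (rule inversion_prod_permute_list[symmetric])
qed

lemma minor_word_quot:
  assumes "\<And>K L. (K, L) \<in> set w \<Longrightarrow> set K \<subseteq> {1..n} \<and> set L \<subseteq> {1..n}"
    and "\<And>K L. (K, L) \<in> set w \<Longrightarrow> M K L = quot (qmatrix_gens n) (qmatrix_rels n P Q) (minor_poly h K L)"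
  shows "list_prod (qmatrix_algebra n P Q) (map (\<lambda>(K, L). M K L) w) =
      quot (qmatrix_gens n) (qmatrix_rels n P Q) (minor_word_poly h w) \<and>
    minor_word_poly h w \<in> carrier (free_algebra (qmatrix_gens n))"
proof -
  interpret qmatrix: presentation "qmatrix_gens n" "qmatrix_rels n P Q"
    by (rule presentation_qmatrix)
  let ?q = "quot (qmatrix_gens n) (qmatrix_rels n P Q)"
  have "map (\<lambda>(K, L). M K L) w = map (\<lambda>x. ?q (case x of (K, L) \<Rightarrow> minor_poly h K L)) w"
    using assms(2) by (intro map_cong) auto
  moreover have "(case x of (K, L) \<Rightarrow> minor_poly h K L) \<in> carrier (free_algebra (qmatrix_gens n))"
    if "x \<in> set w" for x
    using assms(1) that by (cases x) (simp add: minor_poly_closed)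
  ultimately show ?thesis
    using qmatrix.list_prod_quot[of w "\<lambda>(K, L). minor_poly h K L"]
    by (simp only: minor_word_poly_def qmatrix_algebra_def)
qed

section \<open>The correspondence of identities\<close>

lemma minor_wordsD:
  assumes "w \<in> minor_words n V S" "(K, L) \<in> set w"
  shows "set K \<subseteq> {1..n}" "set L \<subseteq> {1..n}" "sorted_wrt (<) K" "sorted_wrt (<) L" "length K = length L"
    "distinct K" "sorted K" "sorted L"
proof -
  show "set K \<subseteq> {1..n}" "set L \<subseteq> {1..n}" and K: "sorted_wrt (<) K" and L: "sorted_wrt (<) L" and "length K = length L"
    using assms unfolding minor_words_def multilabel_def by fast+
  show "distinct K" "sorted K" "sorted L"
    using K L by (simp_all add: strict_sorted_iff)
qed

lemma minor_words_labels:
  assumes "w \<in> minor_words n V S"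
  shows "set (rows w) \<subseteq> {1..n}" "set (cols w) \<subseteq> {1..n}"
  using minor_wordsD(1,2)[OF assms] unfolding rows_def cols_def by fastforce+

text \<open>
  The weights \<open>alpha\<close> for rows and \<open>beta\<close> for columns are those of \<open>twist_qmatrix_rels\<close> that lead from
  the constant parameter \<open>q\<close> to \<open>Q\<close>.  The relation \<open>P i j * Q i j = q\<^sup>2\<close> is exactly what makes them lead from
  \<open>q\<close> to \<open>P\<close> as well.
\<close>

locale parameters =
  fixes n :: nat and q :: "'k::field" and P Q :: "nat \<Rightarrow> nat \<Rightarrow> 'k"
  assumes q: "q \<noteq> 0"
    and P: "\<And>i j. i \<in> {1..n} \<Longrightarrow> j \<in> {1..n} \<Longrightarrow> P i j \<noteq> 0"
    and Q: "\<And>i j. i \<in> {1..n} \<Longrightarrow> j \<in> {1..n} \<Longrightarrow> Q i j \<noteq> 0"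
    and PQ: "\<And>i j. i \<in> {1..n} \<Longrightarrow> j \<in> {1..n} \<Longrightarrow> i < j \<Longrightarrow> P i j * Q i j = q ^ 2"
begin

abbreviation "alpha \<equiv> \<lambda>i j. q / Q i j"
abbreviation "beta \<equiv> \<lambda>i j. Q i j / q"

abbreviation "d_poly \<equiv> minor_word_poly (inversion_prod (\<lambda>i j. - q))"
abbreviation "D_poly \<equiv> minor_word_poly (inversion_prod (\<lambda>i j. - P i j))"
abbreviation "d_ideal \<equiv> rel_ideal (qmatrix_gens n) (qmatrix_rels n (one_param q) (one_param q))"
abbreviation "D_ideal \<equiv> rel_ideal (qmatrix_gens n) (qmatrix_rels n P Q)"

lemma P_eq: "i \<in> {1..n} \<Longrightarrow> j \<in> {1..n} \<Longrightarrow> i < j \<Longrightarrow> P i j = q / Q i j * q"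
  using PQ[of i j] Q[of i j] by (simp add: field_simps power2_eq_square)

lemma alpha_beta_inverse:
  assumes "set J \<subseteq> {1..n}"
  shows "inversion_prod alpha J * inversion_prod beta J = 1"
proof (rule inversion_prod_inverse)
  fix i j assume "i \<in> set J" "j \<in> set J"
  then have "Q i j \<noteq> 0" using assms Q by blast
  then show "alpha i j * beta i j = 1" using q by simp
qed

text \<open>
  The scalar \<open>\<theta>(w)\<close> is the weight of the total row and column labels, because \<open>alpha\<close> and \<open>beta\<close> are
  inverse to the exchange factors of the two algebras of reordering factors.
\<close>

lemma theta_eq:
  assumes "w \<in> minor_words n V S"
  shows "theta n q Q w = inversion_prod alpha (rows w) * inversion_prod beta (cols w)"
proof -
  note labels = minor_words_labels[OF assms]
  from alpha_beta_inverse[OF labels(1)] alpha_beta_inverse[OF labels(2)]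
  have "inverse (inversion_prod beta (rows w)) = inversion_prod alpha (rows w)"
    "inverse (inversion_prod alpha (cols w)) = inversion_prod beta (cols w)"
    by (metis inverse_unique mult.commute)+
  moreover have "zeta_r n q Q (rows w) = inversion_prod beta (rows w)"
    "zeta_l n q Q (cols w) = inversion_prod alpha (cols w)"
    by (intro zeta_r_eq zeta_l_eq labels q Q; assumption)+
  ultimately show ?thesis by (simp add: theta_def)
qed

lemma theta_nonzero: "w \<in> minor_words n V S \<Longrightarrow> theta n q Q w \<noteq> 0"
proof -
  assume w: "w \<in> minor_words n V S"
  note labels = minor_words_labels[OF w]
  from alpha_beta_inverse[OF labels(1)] alpha_beta_inverse[OF labels(2)] show ?thesis
    unfolding theta_eq[OF w] by force
qed

lemma twist_d_ideal:
  assumes "f \<in> d_ideal"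
  shows "twist (reorder_weight alpha beta) f \<in> D_ideal"
proof (rule twist_rel_ideal[OF qmatrix_rels_closed qmatrix_rels_closed qmatrix_rels_homogeneous _ assms])
  fix \<rho> assume \<rho>: "\<rho> \<in> qmatrix_rels n (one_param q) (one_param q)"
  show "twist (reorder_weight alpha beta) \<rho> \<in> qmatrix_rels n P Q"
  proof (rule twist_qmatrix_rels[OF _ _ _ _ \<rho>])
    fix i j assume ij: "i \<in> {1..n}" "j \<in> {1..n}" "i < j"
    show "beta i j \<noteq> 0" "alpha i j = inverse (beta i j)" "Q i j = beta i j * one_param q i j"
      using q Q[OF ij(1,2)] ij(3) by (simp_all add: one_param_def)
    show "P i j = alpha i j * one_param q i j"
      unfolding P_eq[OF ij] using ij(3) by (simp add: one_param_def)
  qed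
qed

lemma twist_D_ideal:
  assumes "f \<in> D_ideal"
  shows "twist (reorder_weight beta alpha) f \<in> d_ideal"
proof (rule twist_rel_ideal[OF qmatrix_rels_closed qmatrix_rels_closed qmatrix_rels_homogeneous _ assms])
  fix \<rho> assume \<rho>: "\<rho> \<in> qmatrix_rels n P Q"
  show "twist (reorder_weight beta alpha) \<rho> \<in> qmatrix_rels n (one_param q) (one_param q)"
  proof (rule twist_qmatrix_rels[OF _ _ _ _ \<rho>])
    fix i j assume ij: "i \<in> {1..n}" "j \<in> {1..n}" "i < j"
    show "alpha i j \<noteq> 0" "beta i j = inverse (alpha i j)" "one_param q i j = alpha i j * Q i j"
      using q Q[OF ij(1,2)] ij(3) by (simp_all add: one_param_def)
    show "one_param q i j = beta i j * P i j"
      unfolding P_eq[OF ij] using q Q[OF ij(1,2)] ij(3) by (simp add: one_param_def)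
  qed
qed

text \<open>
  Interchanging \<open>alpha\<close> and \<open>beta\<close> inverts the weight, so the twist is invertible and the two ideals
  correspond to each other.
\<close>

lemma twist_ideal_iff:
  assumes f: "f \<in> carrier (free_algebra (qmatrix_gens n))"
  shows "twist (reorder_weight alpha beta) f \<in> D_ideal \<longleftrightarrow> f \<in> d_ideal"
proof
  have "reorder_weight beta alpha w * reorder_weight alpha beta w = 1" if "w \<in> Poly_Mapping.keys f" for w
  proof -
    have "set (letters w) \<subseteq> {1..n} \<times> {1..n}"
      using f that by (auto simp: free_algebra_def qmatrix_gens_def)
    then have "set (row_label w) \<subseteq> {1..n}" "set (col_label w) \<subseteq> {1..n}"
      unfolding row_label_def col_label_def by auto
    then have inverse: "inversion_prod alpha (row_label w) * inversion_prod beta (row_label w) = 1"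
      "inversion_prod alpha (col_label w) * inversion_prod beta (col_label w) = 1"
      by (simp_all only: alpha_beta_inverse)
    have "reorder_weight beta alpha w * reorder_weight alpha beta w =
      (inversion_prod alpha (row_label w) * inversion_prod beta (row_label w)) *
      (inversion_prod alpha (col_label w) * inversion_prod beta (col_label w))"
      unfolding reorder_weight_def by (simp only: ac_simps)
    then show ?thesis unfolding inverse by simp
  qed
  then have inverse: "twist (reorder_weight beta alpha) (twist (reorder_weight alpha beta) f) = f"
    unfolding twist_twist by (rule twist_trivial)
  show "f \<in> d_ideal" if "twist (reorder_weight alpha beta) f \<in> D_ideal"
    using twist_D_ideal[OF that] unfolding inverse .
qed (rule twist_d_ideal)

lemma minor_word_poly_cong:
  assumes "\<And>K L J. (K, L) \<in> set w \<Longrightarrow> mset J = mset K \<Longrightarrow> h J = h' J"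
  shows "minor_word_poly h w = minor_word_poly h' w"
proof -
  have "map (\<lambda>(K, L). minor_poly h K L) w = map (\<lambda>(K, L). minor_poly h' K L) w"
  proof (rule map_cong[OF refl])
    fix x assume x: "x \<in> set w"
    obtain K L where KL: "x = (K, L)" by (rule prod.exhaust)
    have "minor_poly h K L = minor_poly h' K L"
      using x unfolding KL by (intro minor_poly_cong assms)
    then show "(case x of (K, L) \<Rightarrow> minor_poly h K L) = (case x of (K, L) \<Rightarrow> minor_poly h' K L)"
      by (simp add: KL)
  qed
  then show ?thesis by (simp only: minor_word_poly_def)
qed

text \<open>
  In the sign of a term each inversion contributes \<open>- q\<close>, and the twist turns it into
  \<open>- q * (q / Q i j) = - P i j\<close>, the exchange factor of the exterior algebra of \<open>P\<close>.
\<close>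

lemma twist_d_poly:
  assumes w: "w \<in> minor_words n V S"
  shows "twist (reorder_weight alpha beta) (d_poly w) = const (theta n q Q w) * D_poly w"
proof -
  have "inversion_prod alpha J * inversion_prod (\<lambda>i j. - q) J = inversion_prod (\<lambda>i j. - P i j) J"
    if "(K, L) \<in> set w" "mset J = mset K" for K L J
  proof -
    have "set J \<subseteq> {1..n}"
      using minor_wordsD(1)[OF w that(1)] mset_eq_setD[OF that(2)] by simp
    then have "P i j = alpha i j * q" if "i \<in> set J" "j \<in> set J" "i < j" for i j
      using that P_eq by blast
    then show ?thesis
      unfolding inversion_prod_mult[symmetric] by (intro inversion_prod_cong) simp
  qed
  then have "minor_word_poly (\<lambda>J. inversion_prod alpha J * inversion_prod (\<lambda>i j. - q) J) w = D_poly w"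
    by (rule minor_word_poly_cong)
  then show ?thesis
    using minor_wordsD(5,7,8)[OF w] by (simp add: twist_minor_word_poly theta_eq[OF w])
qed

lemma d_prod_quot:
  assumes w: "w \<in> minor_words n V S"
  shows "d_prod n q w = quot (qmatrix_gens n) (qmatrix_rels n (one_param q) (one_param q)) (d_poly w)"
    and "d_poly w \<in> carrier (free_algebra (qmatrix_gens n))"
proof -
  have "d_minor n q K L = quot (qmatrix_gens n) (qmatrix_rels n (one_param q) (one_param q)) (minor_poly (inversion_prod (\<lambda>i j. - q)) K L)"
    if "(K, L) \<in> set w" for K L
    using minor_wordsD[OF w that] by (intro d_minor_quot)
  with minor_wordsD(1,2)[OF w]
  have "d_prod n q w = quot (qmatrix_gens n) (qmatrix_rels n (one_param q) (one_param q)) (d_poly w) \<and>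
      d_poly w \<in> carrier (free_algebra (qmatrix_gens n))"
    unfolding d_prod_def by (intro minor_word_quot conjI)
  then show "d_prod n q w = quot (qmatrix_gens n) (qmatrix_rels n (one_param q) (one_param q)) (d_poly w)"
    and "d_poly w \<in> carrier (free_algebra (qmatrix_gens n))" by blast+
qed

lemma D_prod_quot:
  assumes w: "w \<in> minor_words n V S"
  shows "D_prod n P Q w = quot (qmatrix_gens n) (qmatrix_rels n P Q) (D_poly w)"
    and "D_poly w \<in> carrier (free_algebra (qmatrix_gens n))"
proof -
  have "D_minor n P Q K L = quot (qmatrix_gens n) (qmatrix_rels n P Q) (minor_poly (inversion_prod (\<lambda>i j. - P i j)) K L)"
    if "(K, L) \<in> set w" for K L
    using minor_wordsD[OF w that] by (intro D_minor_quot P)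
  with minor_wordsD(1,2)[OF w]
  have "D_prod n P Q w = quot (qmatrix_gens n) (qmatrix_rels n P Q) (D_poly w) \<and>
      D_poly w \<in> carrier (free_algebra (qmatrix_gens n))"
    unfolding D_prod_def by (intro minor_word_quot conjI)
  then show "D_prod n P Q w = quot (qmatrix_gens n) (qmatrix_rels n P Q) (D_poly w)"
    and "D_poly w \<in> carrier (free_algebra (qmatrix_gens n))" by blast+
qed

lemma lin_comb_iff:
  assumes c: "c \<in> fin_families (minor_words n V S)"
  shows "lin_comb (qmatrix_algebra1 n q) c (d_prod n q) = \<zero>\<^bsub>qmatrix_algebra1 n q\<^esub> \<longleftrightarrow>
    lin_comb (qmatrix_algebra n P Q) (\<lambda>w. c w * theta n q Q w) (D_prod n P Q) = \<zero>\<^bsub>qmatrix_algebra n P Q\<^esub>"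
proof -
  interpret d: presentation "qmatrix_gens n" "qmatrix_rels n (one_param q) (one_param q)"
    by (rule presentation_qmatrix)
  interpret D: presentation "qmatrix_gens n" "qmatrix_rels n P Q"
    by (rule presentation_qmatrix)
  have fin: "finite {w. c w \<noteq> 0}" and supp: "\<And>w. c w \<noteq> 0 \<Longrightarrow> w \<in> minor_words n V S"
    using c by (auto simp: fin_families_def)
  have supp_eq: "{w. c w * theta n q Q w \<noteq> 0} = {w. c w \<noteq> 0}"
    using supp theta_nonzero by auto
  have supp': "w \<in> minor_words n V S" if "c w * theta n q Q w \<noteq> 0" for w
    using that by (intro supp) auto
  have "finite {w. c w * theta n q Q w \<noteq> 0}" unfolding supp_eq by (rule fin)
  from D.lin_comb_quot[OF this D_prod_quot(1)[OF supp'] D_prod_quot(2)[OF supp']]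
  have D_eq: "lin_comb (qmatrix_algebra n P Q) (\<lambda>w. c w * theta n q Q w) (D_prod n P Q) = \<zero>\<^bsub>qmatrix_algebra n P Q\<^esub> \<longleftrightarrow>
    (\<Sum>w | c w \<noteq> 0. const (c w * theta n q Q w) * D_poly w) \<in> D_ideal"
    unfolding qmatrix_algebra_def supp_eq .
  have "lin_comb (qmatrix_algebra1 n q) c (d_prod n q) = \<zero>\<^bsub>qmatrix_algebra1 n q\<^esub> \<longleftrightarrow>
    (\<Sum>w | c w \<noteq> 0. const (c w) * d_poly w) \<in> d_ideal"
    unfolding qmatrix_algebra_def
    by (rule d.lin_comb_quot[OF fin d_prod_quot(1)[OF supp] d_prod_quot(2)[OF supp]])
  also have "\<dots> \<longleftrightarrow> twist (reorder_weight alpha beta) (\<Sum>w | c w \<noteq> 0. const (c w) * d_poly w) \<in> D_ideal"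
    by (intro twist_ideal_iff[symmetric] sum_closed free_algebra_closed d_prod_quot(2)[OF supp]) simp
  also have "twist (reorder_weight alpha beta) (\<Sum>w | c w \<noteq> 0. const (c w) * d_poly w) =
    (\<Sum>w | c w \<noteq> 0. const (c w * theta n q Q w) * D_poly w)"
    unfolding twist_linear(5)
  proof (intro sum.cong refl)
    fix w assume "w \<in> {w. c w \<noteq> 0}"
    then have "w \<in> minor_words n V S" by (simp add: supp)
    from twist_d_poly[OF this]
    show "twist (reorder_weight alpha beta) (const (c w) * d_poly w) = const (c w * theta n q Q w) * D_poly w"
      by (simp only: twist_const_mult const_mult mult.assoc)
  qed
  also have "\<dots> \<in> D_ideal \<longleftrightarrow>
    lin_comb (qmatrix_algebra n P Q) (\<lambda>w. c w * theta n q Q w) (D_prod n P Q) = \<zero>\<^bsub>qmatrix_algebra n P Q\<^esub>"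
    by (rule D_eq[symmetric])
  finally show ?thesis .
qed

lemma bij_betw_identities:
  "bij_betw (\<lambda>c w. theta n q Q w * c w)
    (identities (qmatrix_algebra1 n q) (minor_words n V S) (d_prod n q))
    (identities (qmatrix_algebra n P Q) (minor_words n V S) (D_prod n P Q))"
proof (rule bij_betwI[where g = "\<lambda>c w. inverse (theta n q Q w) * c w"])
  let ?W = "minor_words n V S" and ?t = "theta n q Q"
  have cancel: "c w = inverse (?t w) * (?t w * c w)" "c w = ?t w * (inverse (?t w) * c w)"
    if "c \<in> fin_families ?W" for c w
  proof -
    have "c w = 0 \<or> ?t w \<noteq> 0"
      using that theta_nonzero by (auto simp: fin_families_def)
    then show "c w = inverse (?t w) * (?t w * c w)" "c w = ?t w * (inverse (?t w) * c w)" by auto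
  qed
  have scaled: "(\<lambda>w. s w * c w) \<in> fin_families ?W" if "c \<in> fin_families ?W" for s c :: "_ \<Rightarrow> 'k"
    using that unfolding fin_families_def by (auto elim!: finite_subset[rotated])
  show "(\<lambda>c w. ?t w * c w) \<in> identities (qmatrix_algebra1 n q) ?W (d_prod n q) \<rightarrow>
      identities (qmatrix_algebra n P Q) ?W (D_prod n P Q)"
  proof
    fix c assume "c \<in> identities (qmatrix_algebra1 n q) ?W (d_prod n q)"
    then have c: "c \<in> fin_families ?W"
      and zero: "lin_comb (qmatrix_algebra1 n q) c (d_prod n q) = \<zero>\<^bsub>qmatrix_algebra1 n q\<^esub>"
      by (auto simp: identities_def)
    have "lin_comb (qmatrix_algebra n P Q) (\<lambda>w. ?t w * c w) (D_prod n P Q) = \<zero>\<^bsub>qmatrix_algebra n P Q\<^esub>"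
      using lin_comb_iff[OF c] zero by (simp add: mult.commute)
    then show "(\<lambda>w. ?t w * c w) \<in> identities (qmatrix_algebra n P Q) ?W (D_prod n P Q)"
      using scaled[OF c] by (simp add: identities_def)
  qed
  show "(\<lambda>c w. inverse (?t w) * c w) \<in> identities (qmatrix_algebra n P Q) ?W (D_prod n P Q) \<rightarrow>
      identities (qmatrix_algebra1 n q) ?W (d_prod n q)"
  proof
    fix c assume "c \<in> identities (qmatrix_algebra n P Q) ?W (D_prod n P Q)"
    then have c: "c \<in> fin_families ?W" and zero: "lin_comb (qmatrix_algebra n P Q) c (D_prod n P Q) = \<zero>\<^bsub>qmatrix_algebra n P Q\<^esub>"
      by (auto simp: identities_def)
    have "(\<lambda>w. inverse (?t w) * c w * ?t w) = c"
      using cancel(2)[OF c] by (simp add: fun_eq_iff ac_simps)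
    then show "(\<lambda>w. inverse (?t w) * c w) \<in> identities (qmatrix_algebra1 n q) ?W (d_prod n q)"
      using lin_comb_iff[OF scaled[OF c, of "\<lambda>w. inverse (?t w)"]] scaled[OF c] zero
      by (simp add: identities_def)
  qed
  show "(\<lambda>w. inverse (?t w) * (?t w * c w)) = c"
    if "c \<in> identities (qmatrix_algebra1 n q) ?W (d_prod n q)" for c
    using cancel(1)[of c] that by (auto simp: identities_def)
  show "(\<lambda>w. ?t w * (inverse (?t w) * c w)) = c"
    if "c \<in> identities (qmatrix_algebra n P Q) ?W (D_prod n P Q)" for c
    using cancel(2)[of c] that by (auto simp: identities_def)
qed

end

theorem mainTheorem1:
  fixes n :: nat and q :: "'k::field" and P Q :: "nat \<Rightarrow> nat \<Rightarrow> 'k" and V S :: "nat list"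
  assumes "n \<ge> 1"
    and "q \<noteq> 0"
    and "\<And>i j. i \<in> {1..n} \<Longrightarrow> j \<in> {1..n} \<Longrightarrow> P i j \<noteq> 0"
    and "\<And>i j. i \<in> {1..n} \<Longrightarrow> j \<in> {1..n} \<Longrightarrow> Q i j \<noteq> 0"
    and "\<And>i j. i \<in> {1..n} \<Longrightarrow> j \<in> {1..n} \<Longrightarrow> i < j \<Longrightarrow> P i j * Q i j = q ^ 2"
    and "\<And>i j. i \<in> {1..n} \<Longrightarrow> j \<in> {1..n} \<Longrightarrow> i < j \<Longrightarrow> Q i j = inverse (Q j i)"
    and "\<And>i. i \<in> {1..n} \<Longrightarrow> Q i i = P i i"
    and "multilabel n V" and "sorted V"
    and "multilabel n S" and "sorted S"
  shows "(\<forall>w \<in> minor_words n V S. theta n q Q w \<noteq> 0) \<and>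
    (\<forall>c \<in> fin_families (minor_words n V S).
      lin_comb (qmatrix_algebra1 n q) c (d_prod n q) = \<zero>\<^bsub>qmatrix_algebra1 n q\<^esub> \<longleftrightarrow>
      lin_comb (qmatrix_algebra n P Q) (\<lambda>w. c w * theta n q Q w) (D_prod n P Q)
        = \<zero>\<^bsub>qmatrix_algebra n P Q\<^esub>) \<and>
    bij_betw (\<lambda>c w. theta n q Q w * c w)
      (identities (qmatrix_algebra1 n q) (minor_words n V S) (d_prod n q))
      (identities (qmatrix_algebra n P Q) (minor_words n V S) (D_prod n P Q))"
proof -
  interpret parameters n q P Q by unfold_locales (fact assms(2-5))+
  show ?thesis using theta_nonzero lin_comb_iff bij_betw_identities by simp
qed

end
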